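(* $\mathrm{ex}(n,\overrightarrow{C}_5,\overrightarrow{C}_8)=\left(\frac{n}{5}\right)^5+o(n^5)$ and $\mathrm{ex}(n,\overrightarrow{C}_5,\overrightarrow{C}_{13})=\left(\frac{n}{5}\right)^5+o(n^5)$.
   Context: An oriented graph is a directed graph without loops in which every pair of vertices is joined by at most one arc. $\overrightarrow{C}_m$ denotes the directed cycle of length $m$. A copy of $H$ in $G$ is a (not necessarily induced) subgraph isomorphic to $H$. $\mathrm{ex}(n,\overrightarrow{C}_k,\overrightarrow{C}_\ell)$ is the maximum number of copies of $\overrightarrow{C}_k$ in an $n$-vertex oriented graph containing no copy of $\overrightarrow{C}_\ell$. *)

theory Defs
  imports Complex_Main "HOL-Library.Landau_Symbols" "Graph_Theory.Graph_Theory"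
begin

text \<open>
  Arcs are ordered pairs of vertices, so two parallel arcs in the same direction are
  impossible; excluding loops and antiparallel arcs leaves at most one arc per pair of vertices.
\<close>
locale oriented_graph = pair_digraph G for G :: "'a pair_pre_digraph" +
  assumes no_antiparallel: "(u, v) \<in> parcs G \<Longrightarrow> (v, u) \<notin> parcs G"

definition dicycle :: "nat \<Rightarrow> nat pair_pre_digraph" where
  "dicycle m = \<lparr> pverts = {..<m}, parcs = {(i, Suc i mod m) | i. i < m} \<rparr>"

definition copies :: "'b pair_pre_digraph \<Rightarrow> 'a pair_pre_digraph \<Rightarrow> 'a pair_pre_digraph set" where
  "copies H G = {S. subgraph (with_proj S) (with_proj G) \<and> digraph_iso (with_proj H) (with_proj S)}"

text \<open>
  The vertices are taken to be natural numbers; up to isomorphism this covers every finite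
  oriented graph.
\<close>
definition ex_dicycle :: "nat \<Rightarrow> nat \<Rightarrow> nat \<Rightarrow> nat" where
  "ex_dicycle n k l =
     Max {card (copies (dicycle k) G) | G :: nat pair_pre_digraph.
            oriented_graph G \<and> card (pverts G) = n \<and> copies (dicycle l) G = {}}"

lemma finite_copies_card_le:
  assumes "oriented_graph G"
  shows "finite (copies H G)"
    and "card (copies H G) \<le> 2 ^ card (pverts G) * 2 ^ (card (pverts G) * card (pverts G))"
proof -
  interpret oriented_graph G by fact
  let ?f = "\<lambda>S :: 'a pair_pre_digraph. (pverts S, parcs S)"
  let ?B = "Pow (pverts G) \<times> Pow (pverts G \<times> pverts G)"
  have fin: "finite ?B" using pair_finite_verts by simp
  have sub: "?f ` copies H G \<subseteq> ?B"
  proof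
    fix x assume "x \<in> ?f ` copies H G"
    then obtain S where x: "x = ?f S" and S: "pverts S \<subseteq> pverts G" "parcs S \<subseteq> parcs G"
      by (auto simp: copies_def subgraph_def)
    have "parcs G \<subseteq> pverts G \<times> pverts G"
      by (auto dest: wellformed')
    with S show "x \<in> ?B" unfolding x by blast
  qed
  have inj: "inj_on ?f (copies H G)"
    by (auto intro!: inj_onI pair_pre_digraph.equality)
  show "finite (copies H G)"
    using finite_subset[OF sub fin] inj by (rule finite_imageD)
  have "card (copies H G) \<le> card ?B"
    using card_inj_on_le[OF inj sub fin] .
  then show "card (copies H G) \<le> 2 ^ card (pverts G) * 2 ^ (card (pverts G) * card (pverts G))"
    using pair_finite_verts by (simp add: card_cartesian_product card_Pow)
qed

text \<open>For nonempty forbidden cycles, the maximum ranges over a finite nonempty set.\<close>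
lemma ex_dicycle_set:
  fixes n k l :: nat
  defines "A \<equiv> {card (copies (dicycle k) G) | G :: nat pair_pre_digraph.
            oriented_graph G \<and> card (pverts G) = n \<and> copies (dicycle l) G = {}}"
  assumes "0 < l"
  shows "finite A" and "A \<noteq> {}"
proof -
  have "A \<subseteq> {..2 ^ n * 2 ^ (n * n)}"
  proof
    fix c assume "c \<in> A"
    then obtain G :: "nat pair_pre_digraph"
      where "c = card (copies (dicycle k) G)" "oriented_graph G" "card (pverts G) = n"
      unfolding A_def by blast
    then show "c \<in> {..2 ^ n * 2 ^ (n * n)}"
      using finite_copies_card_le(2)[of G "dicycle k"] by simp
  qed
  then show "finite A" by (rule finite_subset) simp
  let ?G = "\<lparr> pverts = {..<n}, parcs = {} \<rparr> :: nat pair_pre_digraph"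
  have "oriented_graph ?G" by unfold_locales auto
  moreover have "copies (dicycle l) ?G = {}"
    using \<open>0 < l\<close> by (auto simp: copies_def subgraph_def digraph_iso_def dicycle_def app_iso_def with_proj_def)
  moreover have "card (pverts ?G) = n" by simp
  ultimately show "A \<noteq> {}" unfolding A_def by blast
qed

end

theory Submission
  imports Defs "HOL-Analysis.Convex"
begin

text \<open>
  Suppose first that there is no closed \<open>l\<close>-walk at all, where \<open>l\<close> is \<open>8\<close> or \<open>13\<close>. Since
  \<open>8 = 3 + 5 = 4 + 4\<close> and \<open>13 = 3 + 5 + 5 = 4 + 4 + 5 = 8 + 5\<close>, a vertex on a closed 5-walk is on no
  closed walk of length 3, 4 or 8. For a closed 5-walk \<open>v\<^sub>0, \<dots>, v\<^sub>4\<close> (indices mod 5) let \<open>A\<^sub>j\<close> be the set of \<open>u\<close>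
  with walks of length 2 from \<open>v\<^bsub>j-2\<^esub>\<close> to \<open>u\<close> and of length 3 back, and \<open>C\<^sub>j\<close> the set of \<open>u\<close> with an arc from
  \<open>v\<^bsub>j-1\<^esub>\<close> and a walk of length 2 to \<open>v\<^bsub>j+2\<^esub>\<close>. Then \<open>C\<^sub>0, \<dots>, C\<^sub>4\<close> are pairwise disjoint, and so are
  \<open>A\<^sub>0, C\<^sub>1, A\<^sub>2, C\<^sub>3, C\<^sub>4\<close>. Hence, on average over the rotations of the walk,
  \<open>|A\<^sub>2| + |C\<^sub>3| + |C\<^sub>1| + |C\<^sub>4|\<close> is at most \<open>4n/5\<close>. Choosing \<open>v\<^sub>0\<close>, \<open>v\<^sub>2\<close> in \<open>A\<^sub>2\<close>, \<open>v\<^sub>3\<close> in \<open>C\<^sub>3\<close>,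
  \<open>v\<^sub>1\<close> in \<open>C\<^sub>1\<close>, \<open>v\<^sub>4\<close> in \<open>C\<^sub>4\<close> in this order shows that the sum of
  \<open>1 / (|A\<^sub>2| |C\<^sub>3| |C\<^sub>1| |C\<^sub>4|)\<close> over all closed 5-walks is at most \<open>n\<close>, so by convexity there are
  at most \<open>n\<^sup>5 / 5\<^sup>4\<close> closed 5-walks.

  A graph without \<open>l\<close>-cycles may have closed \<open>l\<close>-walks, but repeated use of the Cauchy-Schwarz
  inequality shows that each degenerate image of the \<open>l\<close>-cycle has density \<open>o(1)\<close>: otherwise
  duplicating its repeated vertices would produce many \<open>l\<close>-cycles. So almost all samples of \<open>m\<close>
  vertices span no closed \<open>l\<close>-walk, and averaging the exact bound over the samples gives the
  asymptotic one. The lower bound comes from the balanced blow-up of the 5-cycle.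
\<close>

section \<open>Closed 5-walks in the absence of short closed walks\<close>

definition closed5 :: "('a \<times> 'a) set \<Rightarrow> ('a \<times> 'a \<times> 'a \<times> 'a \<times> 'a) set" where
  "closed5 E = {(a, b, c, d, e). (a, b) \<in> E \<and> (b, c) \<in> E \<and> (c, d) \<in> E \<and> (d, e) \<in> E \<and> (e, a) \<in> E}"

text \<open>
  In the notation above, \<open>A\<^sub>j\<close> is \<open>via_far E v\<^bsub>j-2\<^esub>\<close> and \<open>C\<^sub>j\<close> is \<open>via_near E v\<^bsub>j-1\<^esub> v\<^bsub>j+2\<^esub>\<close>.
\<close>

definition via_far :: "('a \<times> 'a) set \<Rightarrow> 'a \<Rightarrow> 'a set" where
  "via_far E x = {u. (x, u) \<in> E ^^ 2 \<and> (u, x) \<in> E ^^ 3}"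

definition via_near :: "('a \<times> 'a) set \<Rightarrow> 'a \<Rightarrow> 'a \<Rightarrow> 'a set" where
  "via_near E x y = {u. (x, u) \<in> E \<and> (u, y) \<in> E ^^ 2}"

lemma relpow_add_trans: "(x, y) \<in> E ^^ i \<Longrightarrow> (y, z) \<in> E ^^ j \<Longrightarrow> (x, z) \<in> E ^^ (i + j)"
  by (auto simp: relpow_add)

lemma relpow_1I: "(x, y) \<in> E \<Longrightarrow> (x, y) \<in> E ^^ 1" for E :: "('a \<times> 'a) set"
  by (simp only: relpow_1)

lemma closed5_relpow:
  assumes "(a, b, c, d, e) \<in> closed5 E"
  shows "(a, c) \<in> E ^^ 2" "(a, d) \<in> E ^^ 3" "(a, e) \<in> E ^^ 4" "(a, a) \<in> E ^^ 5"
proof -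
  have s: "(a, b) \<in> E ^^ 1" "(b, c) \<in> E ^^ 1" "(c, d) \<in> E ^^ 1" "(d, e) \<in> E ^^ 1" "(e, a) \<in> E ^^ 1"
    using assms unfolding relpow_1 by (auto simp: closed5_def)
  show 2: "(a, c) \<in> E ^^ 2" using relpow_add_trans[OF s(1) s(2)] by (simp add: numeral_eq_Suc)
  show 3: "(a, d) \<in> E ^^ 3" using relpow_add_trans[OF 2 s(3)] by (simp add: numeral_eq_Suc)
  show 4: "(a, e) \<in> E ^^ 4" using relpow_add_trans[OF 3 s(4)] by (simp add: numeral_eq_Suc)
  show "(a, a) \<in> E ^^ 5" using relpow_add_trans[OF 4 s(5)] by (simp add: numeral_eq_Suc)
qed

lemma closed5_rotations:
  assumes "(a, b, c, d, e) \<in> closed5 E"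
  shows "(b, c, d, e, a) \<in> closed5 E" "(c, d, e, a, b) \<in> closed5 E"
    "(d, e, a, b, c) \<in> closed5 E" "(e, a, b, c, d) \<in> closed5 E"
  using assms by (auto simp: closed5_def)

text \<open>Rotation permutes \<open>closed5 E\<close>, so a sum over closed 5-walks does not see
  the starting vertex. This turns sums of the five sets attached to a walk into multiples of a
  single total.\<close>

lemma sum_closed5_rotate:
  "(\<Sum>(a, b, c, d, e) \<in> closed5 E. f a b c d e) = (\<Sum>(a, b, c, d, e) \<in> closed5 E. f b c d e a :: real)"
  by (rule sum.reindex_bij_witness[of _ "\<lambda>(a, b, c, d, e). (b, c, d, e, a)" "\<lambda>(a, b, c, d, e). (e, a, b, c, d)"])
    (auto simp: closed5_def)

section \<open>Elementary counting and convexity estimates\<close>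

lemma card_disjoint5:
  assumes finV: "finite V" and sub: "A \<union> B \<union> C \<union> D \<union> F \<subseteq> V"
    and "A \<inter> B = {}" "A \<inter> C = {}" "A \<inter> D = {}" "A \<inter> F = {}" "B \<inter> C = {}"
    "B \<inter> D = {}" "B \<inter> F = {}" "C \<inter> D = {}" "C \<inter> F = {}" "D \<inter> F = {}"
  shows "card A + card B + card C + card D + card F \<le> card V"
proof -
  have fin: "finite A" "finite B" "finite C" "finite D" "finite F"
    using sub finV finite_subset by (metis le_sup_iff)+
  have "card (A \<union> B \<union> C \<union> D \<union> F) = card A + card B + card C + card D + card F"
    using fin assms by (simp add: card_Un_disjoint Int_Un_distrib2)
  then show ?thesis using card_mono[OF finV sub] by simp
qed

lemma sum_inverse_card_le:
  fixes K :: real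
  assumes "\<And>x. x \<in> B \<Longrightarrow> g x \<le> K" "0 \<le> K"
  shows "(\<Sum>x \<in> B. g x / real (card B)) \<le> K"
proof -
  have "(\<Sum>x \<in> B. g x / real (card B)) \<le> (\<Sum>x \<in> B. K / real (card B))"
    by (intro sum_mono divide_right_mono assms) auto
  also have "\<dots> \<le> K" using assms(2) by (cases "card B = 0") auto
  finally show ?thesis .
qed

text \<open>The right-hand side is the tangent plane at (1, 1, 1, 1) of the convex function on the
  left; \<open>ln t \<le> t - 1\<close> and \<open>exp s \<ge> 1 + s\<close> combine to give
  it.\<close>

lemma inverse_product4_ge:
  fixes x y z w :: real
  assumes "0 < x" "0 < y" "0 < z" "0 < w"
  shows "1 / (x * y * z * w) \<ge> 5 - (x + y + z + w)"
proof -
  have "ln (x * y * z * w) \<le> (x - 1) + (y - 1) + (z - 1) + (w - 1)"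
    using assms ln_le_minus_one[of x] ln_le_minus_one[of y] ln_le_minus_one[of z] ln_le_minus_one[of w]
    by (simp add: ln_mult)
  moreover have "1 / (x * y * z * w) = exp (- ln (x * y * z * w))"
    using assms by (simp add: exp_minus field_simps)
  moreover have "exp (- ln (x * y * z * w)) \<ge> 1 + - ln (x * y * z * w)"
    by (rule exp_ge_add_one_self)
  ultimately show ?thesis by linarith
qed

text \<open>A common interface for both forbidden lengths: these are the consequences of having no
  closed walk of length 8, or none of length 13, that the exact bound relies on.\<close>

locale few_closed_walks =
  fixes V :: "'a set" and E :: "('a \<times> 'a) set"
  assumes finV: "finite V" and EV: "E \<subseteq> V \<times> V"
    and no3: "(x, x) \<in> E ^^ 5 \<Longrightarrow> (x, x) \<notin> E ^^ 3"
    and no4: "(x, x) \<in> E ^^ 5 \<Longrightarrow> (x, x) \<notin> E ^^ 4"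
    and no8: "(x, x) \<in> E ^^ 5 \<Longrightarrow> (x, x) \<notin> E ^^ 8"
begin

section \<open>Disjoint vertex sets around a closed 5-walk\<close>

lemma no_closed_path:
  assumes "(x, x) \<in> E ^^ 5" "(x, u) \<in> E ^^ i" "(u, y) \<in> E ^^ j" "(y, x) \<in> E ^^ k"
  shows "i + j + k \<notin> {3, 4, 8}"
  using relpow_add_trans[OF relpow_add_trans[OF assms(2,3)] assms(4)] no3 no4 no8 assms(1) by auto

lemma no_closed_path':
  assumes "(x, x) \<in> E ^^ 5" "(x, u) \<in> E ^^ i" "(u, x) \<in> E ^^ j"
  shows "i + j \<notin> {3, 4, 8}"
  using relpow_add_trans[OF assms(2,3)] no3 no4 no8 assms(1) by auto

text \<open>A common vertex \<open>u\<close> of \<open>C\<^sub>0\<close> and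
  \<open>C\<^sub>1\<close> gives a closed walk through \<open>e\<close>, \<open>u\<close>,
  \<open>d\<close> of length 1 + 2 + 1 = 4; one of \<open>C\<^sub>0\<close> and
  \<open>C\<^sub>2\<close> gives a closed 3-walk at \<open>e\<close>.\<close>

lemma via_near_disjoint:
  assumes "(a, b, c, d, e) \<in> closed5 E"
  shows "via_near E e c \<inter> via_near E a d = {}" "via_near E e c \<inter> via_near E b e = {}"
proof -
  have w: "(e, a, b, c, d) \<in> closed5 E" "(d, e, a, b, c) \<in> closed5 E"
    using assms by (auto simp: closed5_def)
  have de: "(d, e) \<in> E ^^ 1" using assms unfolding relpow_1 by (auto simp: closed5_def)
  note ee = closed5_relpow(4)[OF w(1)]
  show "via_near E e c \<inter> via_near E a d = {}"
    using no_closed_path[OF ee relpow_1I _ de] by (fastforce simp: via_near_def)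
  show "via_near E e c \<inter> via_near E b e = {}"
    using no_closed_path'[OF ee relpow_1I] by (fastforce simp: via_near_def)
qed

text \<open>With \<open>d\<close> as \<open>v\<^sub>3\<close>, the set \<open>via_far E d\<close> is
  \<open>A\<^sub>0\<close>. Meeting \<open>C\<^sub>1\<close> or \<open>C\<^sub>4\<close> would close
  a 4-walk at \<open>d\<close>. The other cases close an 8-walk by adding a segment of the given
  walk: 2 + 2 + 4 for \<open>C\<^sub>2\<close>, 1 + 3 + 4 for \<open>C\<^sub>3\<close>, 2 + 3 + 3
  for \<open>A\<^sub>2\<close>.\<close>

lemma via_far_disjoint:
  assumes "(a, b, c, d, e) \<in> closed5 E"
  shows "via_far E d \<inter> via_near E a d = {}"
    and "via_far E d \<inter> via_near E b e = {}"
    and "via_far E d \<inter> via_near E c a = {}"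
    and "via_far E d \<inter> via_near E d b = {}"
    and "via_far E d \<inter> via_far E a = {}"
proof -
  note w = closed5_rotations[OF assms]
  note d5 = closed5_relpow(4)[OF w(3)] and c5 = closed5_relpow(4)[OF w(2)]
  show "via_far E d \<inter> via_near E a d = {}"
    using no_closed_path'[OF d5] by (fastforce simp: via_near_def via_far_def)
  show "via_far E d \<inter> via_near E b e = {}"
    using no_closed_path[OF d5 _ _ closed5_relpow(3)[OF w(4)]] by (fastforce simp: via_near_def via_far_def)
  show "via_far E d \<inter> via_near E c a = {}"
    using no_closed_path[OF c5 relpow_1I _ closed5_relpow(3)[OF w(3)]]
    by (fastforce simp: via_near_def via_far_def)
  show "via_far E d \<inter> via_near E d b = {}"
    using no_closed_path'[OF d5 relpow_1I] by (fastforce simp: via_near_def via_far_def)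
  show "via_far E d \<inter> via_far E a = {}"
    using no_closed_path[OF d5 _ _ closed5_relpow(2)[OF assms]] by (fastforce simp: via_near_def via_far_def)
qed

lemma relpow_subset: "(x, y) \<in> E ^^ Suc k \<Longrightarrow> x \<in> V \<and> y \<in> V"
proof (induction k arbitrary: y)
  case 0 then show ?case using EV by auto
next
  case (Suc k) then show ?case using EV by (auto elim!: relpow_Suc_E)
qed

lemma via_subset: "via_near E x y \<subseteq> V" "via_far E x \<subseteq> V"
  using EV relpow_subset by (auto simp: via_near_def via_far_def numeral_eq_Suc simp del: relpow.simps)

lemma finite_via: "finite (via_near E x y)" "finite (via_far E x)"
  by (rule finite_subset[OF via_subset(1) finV]) (rule finite_subset[OF via_subset(2) finV])

lemma sum_via_near_le:
  assumes "(a, b, c, d, e) \<in> closed5 E"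
  shows "card (via_near E e c) + card (via_near E a d) + card (via_near E b e)
    + card (via_near E c a) + card (via_near E d b) \<le> card V"
proof -
  note w = closed5_rotations[OF assms]
  \<comment> \<open>Two facts in five rotations cover all ten pairs among the five sets.\<close>
  note n = via_near_disjoint[OF assms] w[THEN via_near_disjoint(1)] w[THEN via_near_disjoint(2)]
  show ?thesis
    by (rule card_disjoint5[OF finV]) (simp_all only: n n[THEN trans[OF Int_commute]] via_subset Un_least)
qed

lemma sum_via_far_le:
  assumes "(a, b, c, d, e) \<in> closed5 E"
  shows "card (via_far E d) + card (via_near E a d) + card (via_far E a)
    + card (via_near E c a) + card (via_near E d b) \<le> card V"
proof -
  note w = closed5_rotations[OF assms]
  note n = via_near_disjoint[OF assms] w[THEN via_near_disjoint(1)] w[THEN via_near_disjoint(2)]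
    \<comment> \<open>The walk itself handles \<open>A\<^sub>0\<close>; its rotation by two handles
      \<open>A\<^sub>2\<close>.\<close>
    and f = via_far_disjoint[OF assms] via_far_disjoint[OF w(2)]
  show ?thesis
    by (rule card_disjoint5[OF finV]) (simp_all only: n n[THEN trans[OF Int_commute]]
      f f[THEN trans[OF Int_commute]] via_subset Un_least)
qed

lemma finite_closed5: "finite (closed5 E)"
  by (rule finite_subset[of _ "V \<times> V \<times> V \<times> V \<times> V"]) (use EV finV in \<open>auto simp: closed5_def\<close>)

section \<open>The weighted count and the exact bound for closed 5-walks\<close>

definition choice_weight :: "'a \<Rightarrow> 'a \<Rightarrow> 'a \<Rightarrow> 'a \<Rightarrow> 'a \<Rightarrow> real" where
  "choice_weight a b c d e = real (card (via_far E a)) * real (card (via_near E c a))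
     * real (card (via_near E a d)) * real (card (via_near E d b))"

lemma sum_inverse_choice_weight_le: "(\<Sum>(a, b, c, d, e) \<in> closed5 E. 1 / choice_weight a b c d e) \<le> card V"
proof -
  \<comment> \<open>In the order \<open>a, c, d, b, e\<close> every set of candidates depends only
    on vertices already chosen.\<close>
  let ?S = "SIGMA a:V. SIGMA c:via_far E a. SIGMA d:via_near E c a. SIGMA b:via_near E a d. via_near E d b"
  let ?f = "\<lambda>(a, c, d, b, e). 1 / choice_weight a b c d e"
  have fin: "finite ?S" using finV finite_via by (intro finite_SigmaI)
  have sub: "(\<lambda>(a, b, c, d, e). (a, c, d, b, e)) ` closed5 E \<subseteq> ?S"
  proof -
    have "(a, c, d, b, e) \<in> ?S" if w0: "(a, b, c, d, e) \<in> closed5 E" for a b c d e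
    proof -
      note w = closed5_rotations[OF w0]
      have s: "a \<in> V" "(c, d) \<in> E" "(a, b) \<in> E" "(d, e) \<in> E"
        using w0 EV by (auto simp: closed5_def)
      note closed5_relpow(1)[OF w0] closed5_relpow(2)[OF w(2)] closed5_relpow(1)[OF w(3)]
        closed5_relpow(1)[OF w(1)] closed5_relpow(1)[OF w(4)]
      with s show ?thesis by (auto simp: via_near_def via_far_def)
    qed
    then show ?thesis by auto
  qed
  have "(\<Sum>(a, b, c, d, e) \<in> closed5 E. 1 / choice_weight a b c d e)
      = (\<Sum>t \<in> (\<lambda>(a, b, c, d, e). (a, c, d, b, e)) ` closed5 E. ?f t)"
    by (subst sum.reindex) (auto simp: inj_on_def case_prod_unfold)
  also have "\<dots> \<le> sum ?f ?S"
  proof (rule sum_mono2[OF fin sub])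
    show "0 \<le> ?f t" for t by (auto simp: choice_weight_def case_prod_unfold)
  qed
  also have "\<dots> = (\<Sum>a\<in>V. \<Sum>c\<in>via_far E a. \<Sum>d\<in>via_near E c a. \<Sum>b\<in>via_near E a d. \<Sum>e\<in>via_near E d b.
      1 / choice_weight a b c d e)"
    using finV finite_via by (simp add: sum.Sigma)
  \<comment> \<open>Each factor of the weight is the size of one summation range, so every inner sum
    is an average and the sums collapse from the inside out.\<close>
  also have "\<dots> = (\<Sum>a\<in>V. \<Sum>c\<in>via_far E a. (\<Sum>d\<in>via_near E c a. (\<Sum>b\<in>via_near E a d. (\<Sum>e\<in>via_near E d b.
      1 / card (via_near E d b)) / card (via_near E a d)) / card (via_near E c a)) / card (via_far E a))"
    unfolding sum_divide_distrib by (intro sum.cong refl) (simp add: choice_weight_def mult_ac)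
  also have "\<dots> \<le> (\<Sum>a\<in>V. 1)"
    by (intro sum_mono sum_inverse_card_le) auto
  finally show ?thesis by simp
qed

lemma card_closed5_le: "625 * real (card (closed5 E)) \<le> real (card V) ^ 5"
proof (cases "closed5 E = {}")
  case False
  let ?T = "closed5 E"
  define n where "n = real (card V)"
  define N where "N = real (card ?T)"
  have npos: "n > 0" using False EV finV by (auto simp: n_def closed5_def card_gt_0_iff)
  define far where "far = (\<Sum>(a, b, c, d, e) \<in> ?T. real (card (via_far E a)))"
  define near where "near = (\<Sum>(a, b, c, d, e) \<in> ?T. real (card (via_near E a d)))"
  note rot = sum_closed5_rotate
  have far4: "(\<Sum>(a, b, c, d, e) \<in> ?T. real (card (via_far E d))) = far"
    unfolding far_def by (subst rot, subst rot, subst rot) simp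
  have near1: "(\<Sum>(a, b, c, d, e) \<in> ?T. real (card (via_near E b e))) = near"
    unfolding near_def by (subst (2) rot) simp
  have near2: "(\<Sum>(a, b, c, d, e) \<in> ?T. real (card (via_near E c a))) = near"
    unfolding near1[symmetric] by (subst (2) rot) simp
  have near3: "(\<Sum>(a, b, c, d, e) \<in> ?T. real (card (via_near E d b))) = near"
    unfolding near2[symmetric] by (subst (2) rot) simp
  have near4: "(\<Sum>(a, b, c, d, e) \<in> ?T. real (card (via_near E e c))) = near"
    unfolding near3[symmetric] by (subst (2) rot) simp
  have "(\<Sum>(a, b, c, d, e) \<in> ?T. real (card (via_near E e c)) + real (card (via_near E a d))
      + real (card (via_near E b e)) + real (card (via_near E c a)) + real (card (via_near E d b))) \<le> (\<Sum>t\<in>?T. n)"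
    using sum_via_near_le by (intro sum_mono) (fastforce simp: n_def)
  then have 1: "5 * near \<le> n * N"
    using near1 near2 near3 near4 near_def
    by (simp add: case_prod_unfold sum.distrib N_def mult.commute)
  have "(\<Sum>(a, b, c, d, e) \<in> ?T. real (card (via_far E d)) + real (card (via_near E a d))
      + real (card (via_far E a)) + real (card (via_near E c a)) + real (card (via_near E d b))) \<le> (\<Sum>t\<in>?T. n)"
    using sum_via_far_le by (intro sum_mono) (fastforce simp: n_def)
  then have 2: "2 * far + 3 * near \<le> n * N"
    using near2 near3 far4 near_def far_def
    by (simp add: case_prod_unfold sum.distrib N_def mult.commute)
  have "(\<Sum>(a, b, c, d, e) \<in> ?T. real (card (via_far E a)) + real (card (via_near E c a))
     + real (card (via_near E a d)) + real (card (via_near E d b))) = far + 3 * near"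
    using near2 near3 near_def far_def by (simp add: case_prod_unfold sum.distrib)
  then have "5 * N - 5 / n * (far + 3 * near) = (\<Sum>(a, b, c, d, e) \<in> ?T. 5 - 5 / n * (real (card (via_far E a))
     + real (card (via_near E c a)) + real (card (via_near E a d)) + real (card (via_near E d b))))"
    unfolding case_prod_unfold by (simp only: sum_subtractf flip: sum_distrib_left) (simp add: N_def)
  also have "\<dots> \<le> (\<Sum>(a, b, c, d, e) \<in> ?T. (n / 5) ^ 4 * (1 / choice_weight a b c d e))"
  proof (rule sum_mono, clarify)
    fix a b c d e assume w0: "(a, b, c, d, e) \<in> ?T"
    note w = closed5_rotations[OF w0]
    have s: "(c, d) \<in> E" "(a, b) \<in> E" "(d, e) \<in> E"
      using w0 by (auto simp: closed5_def)
    have "c \<in> via_far E a" "d \<in> via_near E c a" "b \<in> via_near E a d" "e \<in> via_near E d b"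
      using s closed5_relpow(1)[OF w0] closed5_relpow(2)[OF w(2)] closed5_relpow(1)[OF w(3)]
        closed5_relpow(1)[OF w(1)] closed5_relpow(1)[OF w(4)]
      by (auto simp: via_near_def via_far_def)
    then have pos: "0 < card (via_far E a)" "0 < card (via_near E c a)" "0 < card (via_near E a d)"
      "0 < card (via_near E d b)"
      using finite_via by (auto simp: card_gt_0_iff)
    \<comment> \<open>The scaling by \<open>5 / n\<close> puts the point of tangency where all four
      sets have \<open>n / 5\<close> vertices, as in the balanced blow-up of the 5-cycle.\<close>
    have "5 - (5 / n * card (via_far E a) + 5 / n * card (via_near E c a)
        + 5 / n * card (via_near E a d) + 5 / n * card (via_near E d b))
      \<le> 1 / ((5 / n * card (via_far E a)) * (5 / n * card (via_near E c a))
        * (5 / n * card (via_near E a d)) * (5 / n * card (via_near E d b)))"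
      using pos npos by (intro inverse_product4_ge) auto
    also have "\<dots> = (n / 5) ^ 4 * (1 / choice_weight a b c d e)"
      using npos pos by (simp add: choice_weight_def field_simps power4_eq_xxxx)
    finally show "5 - 5 / n * (real (card (via_far E a)) + real (card (via_near E c a))
        + real (card (via_near E a d)) + real (card (via_near E d b))) \<le> (n / 5) ^ 4 * (1 / choice_weight a b c d e)"
      by (simp add: algebra_simps)
  qed
  also have "\<dots> = (n / 5) ^ 4 * (\<Sum>(a, b, c, d, e) \<in> ?T. 1 / choice_weight a b c d e)"
    by (simp add: sum_distrib_left case_prod_unfold)
  also have "\<dots> \<le> (n / 5) ^ 4 * n"
    using sum_inverse_choice_weight_le by (intro mult_left_mono) (auto simp: n_def)
  finally have "5 * N - 5 / n * (far + 3 * near) \<le> (n / 5) ^ 4 * n" .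
  \<comment> \<open>Half of inequality 2 plus 3/10 of inequality 1.\<close>
  moreover have "5 / n * (far + 3 * near) \<le> 5 / n * (4 / 5 * (n * N))"
    using 1 2 npos by (intro mult_left_mono) auto
  then have "5 / n * (far + 3 * near) \<le> 4 * N" using npos by simp
  ultimately have "5 * N - 4 * N \<le> (n / 5) ^ 4 * n"
    by (meson diff_left_mono order_trans)
  then have "N \<le> (n / 5) ^ 4 * n" by simp
  then show ?thesis by (simp add: N_def n_def power_divide field_simps eval_nat_numeral)
qed simp

end

section \<open>Densities of closed walk patterns\<close>

definition closed_walk :: "nat \<Rightarrow> ('a \<times> 'a) set \<Rightarrow> (nat \<Rightarrow> 'a) \<Rightarrow> bool" where
  "closed_walk k E f \<longleftrightarrow> (\<forall>j<k. (f j, f (Suc j mod k)) \<in> E)"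

definition closed_walks :: "nat \<Rightarrow> 'a set \<Rightarrow> ('a \<times> 'a) set \<Rightarrow> (nat \<Rightarrow> 'a) set" where
  "closed_walks k V E = {f \<in> {..<k} \<rightarrow>\<^sub>E V. closed_walk k E f}"

text \<open>Here \<open>J\<close> is a set of variables and \<open>i\<close> names the variable at
  each position of the walk. Positions sharing a variable are identified, so this is the
  homomorphism density of a degenerate image of the \<open>k\<close>-cycle, possibly with isolated
  vertices.\<close>

definition walk_density :: "nat \<Rightarrow> 'a set \<Rightarrow> ('a \<times> 'a) set \<Rightarrow> 'b set \<Rightarrow> (nat \<Rightarrow> 'b) \<Rightarrow> real" where
  "walk_density k V E J i = card {\<phi> \<in> J \<rightarrow>\<^sub>E V. closed_walk k E (\<phi> \<circ> i)} / real (card V) ^ card J"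

lemma closed_walk_cong:
  assumes "\<And>j. j < k \<Longrightarrow> f j = g j"
  shows "closed_walk k E f = closed_walk k E g"
proof -
  have "Suc j mod k < k" if "j < k" for j using that by auto
  then show ?thesis using assms by (auto simp: closed_walk_def)
qed

section \<open>Counting maps with an injective or non-injective pattern\<close>

lemma card_noninj_le:
  assumes "finite V"
  shows "card {f \<in> {..<k} \<rightarrow>\<^sub>E V. \<not> inj_on f {..<k}} \<le> k\<^sup>2 * card V ^ (k - 1)"
proof -
  let ?P = "{..<k} \<times> {..<k} - Id"
  let ?F = "\<lambda>(a, b). {f \<in> {..<k} \<rightarrow>\<^sub>E V. f a = f b}"
  have F: "card (?F p) \<le> card V ^ (k - 1)" if pP: "p \<in> ?P" for p
  proof -
    obtain a b where p: "p = (a, b)" "a < k" "b < k" "a \<noteq> b" using pP by auto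
    have "inj_on (\<lambda>f. restrict f ({..<k} - {a})) (?F p)"
    proof (rule inj_onI)
      fix f g assume f: "f \<in> ?F p" and g: "g \<in> ?F p"
        and eq: "restrict f ({..<k} - {a}) = restrict g ({..<k} - {a})"
      have e: "f x = g x" if "x < k" "x \<noteq> a" for x
        using fun_cong[OF eq, of x] that by simp
      show "f = g"
      proof (rule PiE_ext)
        show "f \<in> {..<k} \<rightarrow>\<^sub>E V" "g \<in> {..<k} \<rightarrow>\<^sub>E V" using f g p by auto
        fix x assume "x \<in> {..<k}"
        then show "f x = g x" using e[of x] e[of b] f g p by (cases "x = a") auto
      qed
    qed
    moreover have "(\<lambda>f. restrict f ({..<k} - {a})) ` ?F p \<subseteq> ({..<k} - {a}) \<rightarrow>\<^sub>E V"
      unfolding p(1) by (intro image_subsetI, unfold restrict_PiE_iff) auto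
    ultimately have "card (?F p) \<le> card (({..<k} - {a}) \<rightarrow>\<^sub>E V)"
      using assms by (intro card_inj_on_le) (auto intro: finite_PiE)
    also have "\<dots> = card V ^ (k - 1)" using p by (simp add: card_funcsetE)
    finally show ?thesis .
  qed
  have "{f \<in> {..<k} \<rightarrow>\<^sub>E V. \<not> inj_on f {..<k}} \<subseteq> (\<Union>p\<in>?P. ?F p)"
    by (auto simp: inj_on_def)
  then have "card {f \<in> {..<k} \<rightarrow>\<^sub>E V. \<not> inj_on f {..<k}} \<le> card (\<Union>p\<in>?P. ?F p)"
    using assms by (intro card_mono) (auto intro!: finite_PiE)
  also have "\<dots> \<le> (\<Sum>p\<in>?P. card (?F p))" by (rule card_UN_le) simp
  also have "\<dots> \<le> (\<Sum>p\<in>?P. card V ^ (k - 1))" by (intro sum_mono F)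
  also have "\<dots> \<le> card ({..<k} \<times> {..<k}) * card V ^ (k - 1)"
    unfolding sum_constant of_nat_id by (intro mult_right_mono card_mono) auto
  finally show ?thesis by (simp add: power2_eq_square)
qed

lemma card_PiE_inj_pullback:
  fixes i :: "'c \<Rightarrow> 'b"
  assumes "finite J" and sub: "i ` A \<subseteq> J" and inj: "inj_on i A"
  shows "card {\<phi> \<in> J \<rightarrow>\<^sub>E V. P (restrict (\<phi> \<circ> i) A)} = card {f \<in> A \<rightarrow>\<^sub>E V. P f} * card V ^ (card J - card A)"
proof -
  let ?K = "J - i ` A"
  let ?g = "\<lambda>(f, \<psi>) x. if x \<in> i ` A then f (the_inv_into A i x) else \<psi> x"
  have inv: "the_inv_into A i (i x) = x" if "x \<in> A" for x using inj that by (rule the_inv_into_f_f)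
  have ext: "\<psi> x = undefined" if "\<psi> \<in> ?K \<rightarrow>\<^sub>E V" "x \<notin> J" for \<psi> x
    using that by (auto simp: PiE_def extensional_def)
  have "bij_betw (\<lambda>\<phi>. (restrict (\<phi> \<circ> i) A, restrict \<phi> ?K)) {\<phi> \<in> J \<rightarrow>\<^sub>E V. P (restrict (\<phi> \<circ> i) A)}
    ({f \<in> A \<rightarrow>\<^sub>E V. P f} \<times> (?K \<rightarrow>\<^sub>E V))"
  proof (rule bij_betw_byWitness[where f' = ?g])
    show "\<forall>\<phi>\<in>{\<phi> \<in> J \<rightarrow>\<^sub>E V. P (restrict (\<phi> \<circ> i) A)}. ?g (restrict (\<phi> \<circ> i) A, restrict \<phi> ?K) = \<phi>"
    proof
      fix \<phi> assume "\<phi> \<in> {\<phi> \<in> J \<rightarrow>\<^sub>E V. P (restrict (\<phi> \<circ> i) A)}"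
      then have \<phi>: "\<phi> \<in> J \<rightarrow>\<^sub>E V" by simp
      show "?g (restrict (\<phi> \<circ> i) A, restrict \<phi> ?K) = \<phi>"
        using \<phi> sub by (auto simp: fun_eq_iff inv PiE_def extensional_def restrict_def)
    qed
    have left: "restrict (?g (f, \<psi>) \<circ> i) A = f" if "f \<in> A \<rightarrow>\<^sub>E V" for f \<psi>
      using that by (auto simp: fun_eq_iff inv PiE_def extensional_def restrict_def)
    have right: "restrict (?g (f, \<psi>)) ?K = \<psi>" if "\<psi> \<in> ?K \<rightarrow>\<^sub>E V" for f \<psi>
      using that by (auto simp: fun_eq_iff PiE_def extensional_def restrict_def)
    show "\<forall>p\<in>{f \<in> A \<rightarrow>\<^sub>E V. P f} \<times> (?K \<rightarrow>\<^sub>E V). (restrict (?g p \<circ> i) A, restrict (?g p) ?K) = p"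
      using left right by auto
    show "(\<lambda>\<phi>. (restrict (\<phi> \<circ> i) A, restrict \<phi> ?K)) ` {\<phi> \<in> J \<rightarrow>\<^sub>E V. P (restrict (\<phi> \<circ> i) A)}
      \<subseteq> {f \<in> A \<rightarrow>\<^sub>E V. P f} \<times> (?K \<rightarrow>\<^sub>E V)"
      using sub by (auto simp: PiE_iff split: if_splits)
    have "?g (f, \<psi>) \<in> {\<phi> \<in> J \<rightarrow>\<^sub>E V. P (restrict (\<phi> \<circ> i) A)}"
      if f: "f \<in> A \<rightarrow>\<^sub>E V" "P f" and \<psi>: "\<psi> \<in> ?K \<rightarrow>\<^sub>E V" for f \<psi>
    proof -
      have "?g (f, \<psi>) \<in> J \<rightarrow>\<^sub>E V"
        using PiE_mem[OF f(1)] PiE_mem[OF \<psi>] sub ext[OF \<psi>] by (intro PiE_I) (auto simp: inv)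
      then show ?thesis using left[OF f(1), of \<psi>] f(2) by simp
    qed
    then show "?g ` ({f \<in> A \<rightarrow>\<^sub>E V. P f} \<times> (?K \<rightarrow>\<^sub>E V)) \<subseteq> {\<phi> \<in> J \<rightarrow>\<^sub>E V. P (restrict (\<phi> \<circ> i) A)}"
      by blast
  qed
  then have "card {\<phi> \<in> J \<rightarrow>\<^sub>E V. P (restrict (\<phi> \<circ> i) A)} = card ({f \<in> A \<rightarrow>\<^sub>E V. P f} \<times> (?K \<rightarrow>\<^sub>E V))"
    by (rule bij_betw_same_card)
  also have "\<dots> = card {f \<in> A \<rightarrow>\<^sub>E V. P f} * card V ^ card ?K"
    using assms by (simp add: card_cartesian_product card_funcsetE)
  also have "card ?K = card J - card A"
    using assms by (simp add: card_Diff_subset finite_subset card_image)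
  finally show ?thesis .
qed

lemma card_closed_walk_comp_inj:
  assumes "finite J" "i ` {..<k} \<subseteq> J" "inj_on i {..<k}"
  shows "card {\<phi> \<in> J \<rightarrow>\<^sub>E V. closed_walk k E (\<phi> \<circ> i)} = card (closed_walks k V E) * card V ^ (card J - k)"
proof -
  have "closed_walk k E (restrict (\<phi> \<circ> i) {..<k}) = closed_walk k E (\<phi> \<circ> i)" for \<phi>
    by (rule closed_walk_cong) simp
  then show ?thesis
    using card_PiE_inj_pullback[OF assms, of V "closed_walk k E"] by (simp add: closed_walks_def)
qed

lemma walk_density_inj:
  assumes "finite J" "i ` {..<k} \<subseteq> J" "inj_on i {..<k}" "0 < card V"
  shows "walk_density k V E J i = card (closed_walks k V E) / real (card V) ^ k"
proof -
  have "k \<le> card J"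
    using card_inj_on_le[OF assms(3,2,1)] by simp
  then have "real (card V) ^ card J = real (card V) ^ (card J - k) * real (card V) ^ k"
    by (simp flip: power_add)
  then show ?thesis
    using assms(4) by (simp add: walk_density_def card_closed_walk_comp_inj[OF assms(1-3)])
qed

text \<open>One use of Cauchy-Schwarz: the variable shared by \<open>a\<close> and \<open>b\<close>
  is duplicated, the copy \<open>z\<close> taking over position \<open>a\<close>, at the cost of
  squaring the density.\<close>

lemma walk_density_split:
  assumes J: "finite J" "i ` {..<k} \<subseteq> J" "z \<notin> J" and V: "finite V" "0 < card V"
    and ab: "a < k" "b < k" "a \<noteq> b" "i a = i b" and irr: "irrefl E"
  shows "(walk_density k V E J i)\<^sup>2 \<le> walk_density k V E (insert z J) (i(a := z))"
proof -
  define c where "c = i a"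
  let ?K = "J - {c}"
  have cJ: "c \<in> J" using ab J unfolding c_def by auto
  let ?n = "real (card V)"
  let ?R = "\<lambda>\<psi>. {x \<in> V. closed_walk k E (\<psi>(c := x) \<circ> i)}"
  let ?S = "{\<phi> \<in> J \<rightarrow>\<^sub>E V. closed_walk k E (\<phi> \<circ> i)}"
  let ?S' = "{\<phi> \<in> insert z J \<rightarrow>\<^sub>E V. closed_walk k E (\<phi> \<circ> i(a := z))}"
  have finK: "finite (?K \<rightarrow>\<^sub>E V)" using J V by (intro finite_PiE) auto
  have "?S \<subseteq> (\<lambda>(\<psi>, x). \<psi>(c := x)) ` (SIGMA \<psi>:?K \<rightarrow>\<^sub>E V. ?R \<psi>)"
  proof
    fix \<phi> assume \<phi>: "\<phi> \<in> ?S"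
    then have "(restrict \<phi> ?K)(c := \<phi> c) = \<phi>"
      using cJ by (auto simp: fun_eq_iff PiE_def extensional_def)
    then show "\<phi> \<in> (\<lambda>(\<psi>, x). \<psi>(c := x)) ` (SIGMA \<psi>:?K \<rightarrow>\<^sub>E V. ?R \<psi>)"
      using \<phi> cJ by (intro image_eqI[of _ _ "(restrict \<phi> ?K, \<phi> c)"]) auto
  qed
  then have "card ?S \<le> card (SIGMA \<psi>:?K \<rightarrow>\<^sub>E V. ?R \<psi>)"
    using finK V by (intro surj_card_le) auto
  also have "\<dots> = (\<Sum>\<psi>\<in>?K \<rightarrow>\<^sub>E V. card (?R \<psi>))"
    using finK V by simp
  finally have "real (card ?S) \<le> (\<Sum>\<psi>\<in>?K \<rightarrow>\<^sub>E V. real (card (?R \<psi>)))"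
    by (simp flip: of_nat_sum)
  then have "(real (card ?S))\<^sup>2 \<le> (\<Sum>\<psi>\<in>?K \<rightarrow>\<^sub>E V. real (card (?R \<psi>)))\<^sup>2"
    by (intro power_mono) auto
  \<comment> \<open>Cauchy-Schwarz over the assignments \<open>\<psi>\<close> of all variables but
    \<open>c\<close>; \<open>?R \<psi>\<close> holds the admissible values of
    \<open>c\<close>.\<close>
  also have "\<dots> \<le> real (card (?K \<rightarrow>\<^sub>E V)) * (\<Sum>\<psi>\<in>?K \<rightarrow>\<^sub>E V. (real (card (?R \<psi>)))\<^sup>2)"
    using sum_squared_le_sum_of_squares[of "\<lambda>\<psi>. real (card (?R \<psi>))" "?K \<rightarrow>\<^sub>E V"] by (simp add: mult.commute)
  also have "card (?K \<rightarrow>\<^sub>E V) = card V ^ (card J - 1)"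
    using J cJ by (simp add: card_funcsetE)
  also have "(\<Sum>\<psi>\<in>?K \<rightarrow>\<^sub>E V. (real (card (?R \<psi>)))\<^sup>2) \<le> card ?S'"
  proof -
    \<comment> \<open>Two admissible values for the same \<open>\<psi>\<close> are placed on
      \<open>c\<close> and on its copy \<open>z\<close>.\<close>
    let ?h = "\<lambda>(\<psi>, x, y). \<psi>(c := x, z := y)"
    let ?D = "SIGMA \<psi>:?K \<rightarrow>\<^sub>E V. ?R \<psi> \<times> ?R \<psi>"
    have cz: "c \<noteq> z" using cJ J by auto
    have "inj_on ?h ?D"
    proof (rule inj_onI)
      fix p p' assume p: "p \<in> ?D" "p' \<in> ?D" "?h p = ?h p'"
      obtain \<psi> x y \<psi>' x' y' where pp: "p = (\<psi>, x, y)" "p' = (\<psi>', x', y')" by (cases p, cases p') auto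
      have A: "\<psi> \<in> ?K \<rightarrow>\<^sub>E V" "\<psi>' \<in> ?K \<rightarrow>\<^sub>E V" and eq: "\<psi>(c := x, z := y) = \<psi>'(c := x', z := y')"
        using p unfolding pp by auto
      have "x = x'" using fun_cong[OF eq, of c] cz by simp
      moreover have "y = y'" using fun_cong[OF eq, of z] by simp
      moreover have "\<psi> = \<psi>'"
      proof (rule PiE_ext[OF A])
        fix w assume "w \<in> ?K"
        then have "w \<noteq> c" "w \<noteq> z" using J by auto
        then show "\<psi> w = \<psi>' w" using fun_cong[OF eq, of w] by simp
      qed
      ultimately show "p = p'" unfolding pp by simp
    qed
    moreover have key: "\<psi>(c := x, z := y) \<in> ?S'"
      if \<psi>: "\<psi> \<in> ?K \<rightarrow>\<^sub>E V" and x: "x \<in> V" "closed_walk k E (\<psi>(c := x) \<circ> i)"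
        and y: "y \<in> V" "closed_walk k E (\<psi>(c := y) \<circ> i)" for \<psi> x y
    proof -
      let ?\<phi> = "\<psi>(c := x, z := y)"
      have "?\<phi> \<in> insert z J \<rightarrow>\<^sub>E V"
        using \<psi> x(1) y(1) cJ by (auto simp: PiE_def extensional_def Pi_def)
      moreover have "closed_walk k E (?\<phi> \<circ> i(a := z))"
        unfolding closed_walk_def
      proof (intro allI impI)
        fix j assume j: "j < k"
        let ?j = "Suc j mod k"
        have j': "?j < k" using j by auto
        have "i j \<in> J" "i ?j \<in> J" using J(2) j j' by blast+
        then have iz: "i j \<noteq> z" "i ?j \<noteq> z" using J(3) by auto
        have ex: "((\<psi>(c := x)) (i j), (\<psi>(c := x)) (i ?j)) \<in> E" and ey: "((\<psi>(c := y)) (i j), (\<psi>(c := y)) (i ?j)) \<in> E"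
          using x(2) y(2) j by (auto simp: closed_walk_def)
        \<comment> \<open>consecutive positions are never both sent to \<open>c\<close>, since \<open>E\<close> has no loops\<close>
        have "\<not> (i j = c \<and> i ?j = c)" using ex irr by (auto simp: irrefl_def)
        then show "((?\<phi> \<circ> i(a := z)) j, (?\<phi> \<circ> i(a := z)) ?j) \<in> E"
          using ex ey iz c_def by (auto split: if_splits)
      qed
      ultimately show "?\<phi> \<in> ?S'" by simp
    qed
    have "?h ` ?D \<subseteq> ?S'"
    proof (rule image_subsetI)
      fix p assume "p \<in> ?D"
      moreover obtain \<psi> x y where p: "p = (\<psi>, x, y)" by (cases p) auto
      ultimately show "?h p \<in> ?S'" using key[of \<psi> x y] unfolding p by simp
    qed
    moreover have "finite ?S'" using J V by (auto intro!: finite_PiE)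
    ultimately have "card ?D \<le> card ?S'" by (rule card_inj_on_le)
    moreover have "card ?D = (\<Sum>\<psi>\<in>?K \<rightarrow>\<^sub>E V. (card (?R \<psi>))\<^sup>2)"
      using finK V by (simp add: card_cartesian_product power2_eq_square)
    ultimately show ?thesis by (simp flip: of_nat_power of_nat_sum)
  qed
  finally have le: "(real (card ?S))\<^sup>2 \<le> ?n ^ (card J - 1) * card ?S'"
    by (simp add: mult_left_mono o_def)
  have cJ1: "card J = Suc (card J - 1)" using cJ J by (metis Suc_pred' card_gt_0_iff empty_iff)
  have pw: "(?n ^ card J)\<^sup>2 = ?n ^ (card J - 1) * ?n ^ Suc (card J)"
    by (subst (1 3) cJ1) (simp add: power2_eq_square mult_ac)
  have "(walk_density k V E J i)\<^sup>2 = (real (card ?S))\<^sup>2 / (?n ^ card J)\<^sup>2"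
    by (simp add: walk_density_def power_divide)
  also have "\<dots> \<le> ?n ^ (card J - 1) * card ?S' / (?n ^ (card J - 1) * ?n ^ Suc (card J))"
    unfolding pw by (intro divide_right_mono le) auto
  also have "\<dots> = walk_density k V E (insert z J) (i(a := z))"
    using V J by (simp add: walk_density_def)
  finally show ?thesis .
qed

lemma walk_density_bounds:
  assumes "finite J" "finite V" "0 < card V"
  shows "0 \<le> walk_density k V E J i" "walk_density k V E J i \<le> 1"
proof -
  have "card {\<phi> \<in> J \<rightarrow>\<^sub>E V. closed_walk k E (\<phi> \<circ> i)} \<le> card (J \<rightarrow>\<^sub>E V)"
    using assms by (intro card_mono) (auto intro: finite_PiE)
  also have "\<dots> = card V ^ card J" using assms by (simp add: card_funcsetE)
  finally have "real (card {\<phi> \<in> J \<rightarrow>\<^sub>E V. closed_walk k E (\<phi> \<circ> i)}) \<le> real (card V) ^ card J"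
    by (simp flip: of_nat_power)
  then show "walk_density k V E J i \<le> 1" using assms by (simp add: walk_density_def)
qed (simp add: walk_density_def)

lemma walk_density_power_le:
  fixes J :: "nat set"
  assumes "finite V" "0 < card V" "irrefl E" "finite J" "i ` {..<k} \<subseteq> J"
  shows "walk_density k V E J i ^ (2 ^ (k - card (i ` {..<k}))) \<le> card (closed_walks k V E) / real (card V) ^ k"
  using assms(4,5)
proof (induction "k - card (i ` {..<k})" arbitrary: i J)
  case 0
  have "card (i ` {..<k}) = k" using 0 card_image_le[of "{..<k}" i] by simp
  then have "inj_on i {..<k}" by (intro eq_card_imp_inj_on) auto
  then show ?case using walk_density_inj[OF 0(2,3) _ assms(2), of E] by (simp flip: 0(1))
next
  case (Suc d)
  have "\<not> inj_on i {..<k}" using Suc(2) card_image[of i "{..<k}"] by auto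
  then obtain a b where ab: "a < k" "b < k" "a \<noteq> b" "i a = i b" by (auto simp: inj_on_def)
  obtain z where z: "z \<notin> J" using Suc.prems(1) ex_new_if_finite infinite_UNIV_nat by blast
  let ?i = "i(a := z)"
  \<comment> \<open>The old value of \<open>a\<close> is still attained at \<open>b\<close>.\<close>
  have im: "?i ` {..<k} = insert z (i ` {..<k})"
  proof (intro equalityI subsetI)
    fix x assume "x \<in> insert z (i ` {..<k})"
    then consider "x = z" | j where "j < k" "x = i j" by auto
    then show "x \<in> ?i ` {..<k}"
    proof cases
      case 1 then show ?thesis using ab by (intro image_eqI[of _ _ a]) auto
    next
      case 2 then show ?thesis using ab by (cases "j = a") (auto intro!: image_eqI[of _ _ b] image_eqI[of _ _ j])
    qed
  qed auto
  have cd: "card (?i ` {..<k}) = Suc (card (i ` {..<k}))"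
    unfolding im using z Suc.prems(2) by (subst card_insert_disjoint) auto
  then have d: "d = k - card (?i ` {..<k})" using Suc(2) by simp
  have e: "k - card (i ` {..<k}) = Suc (k - card (?i ` {..<k}))" using d Suc(2) by simp
  have "walk_density k V E J i ^ (2 ^ (k - card (i ` {..<k})))
      = ((walk_density k V E J i)\<^sup>2) ^ (2 ^ (k - card (?i ` {..<k})))"
    unfolding e by (simp add: power_mult)
  also have "\<dots> \<le> walk_density k V E (insert z J) ?i ^ (2 ^ (k - card (?i ` {..<k})))"
    using walk_density_split[OF Suc.prems z assms(1,2) ab assms(3)] by (intro power_mono) auto
  also have "\<dots> \<le> card (closed_walks k V E) / real (card V) ^ k"
    using Suc(1)[OF d] Suc.prems im by auto
  finally show ?case .
qed

text \<open>Non-injective walks form a fraction of at most \<open>k\<^sup>2 / card V\<close> of all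
  maps. Since densities lie in [0, 1], the exponent may be raised to \<open>2 ^ k\<close>, the same
  for every pattern.\<close>

lemma walk_density_power_le_of_no_cycle:
  fixes J :: "nat set"
  assumes V: "finite V" "0 < card V" and E: "irrefl E" and J: "finite J" "i ` {..<k} \<subseteq> J" and k: "0 < k"
    and no: "\<And>f. f \<in> closed_walks k V E \<Longrightarrow> \<not> inj_on f {..<k}"
  shows "walk_density k V E J i ^ (2 ^ k) \<le> real k ^ 2 / card V"
proof -
  have "walk_density k V E J i ^ (2 ^ k) \<le> walk_density k V E J i ^ (2 ^ (k - card (i ` {..<k})))"
    using walk_density_bounds[OF J(1) V] by (rule power_decreasing[rotated]) simp
  also have "\<dots> \<le> card (closed_walks k V E) / real (card V) ^ k"
    by (rule walk_density_power_le[OF V E J])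
  also have "\<dots> \<le> (real k ^ 2 * real (card V) ^ (k - 1)) / real (card V) ^ k"
  proof -
    have "card (closed_walks k V E) \<le> card {f \<in> {..<k} \<rightarrow>\<^sub>E V. \<not> inj_on f {..<k}}"
      using no V by (intro card_mono) (auto simp: closed_walks_def intro!: finite_PiE)
    also note card_noninj_le[OF V(1), of k]
    finally have "real (card (closed_walks k V E)) \<le> real (k\<^sup>2 * card V ^ (k - 1))" by (simp only: of_nat_le_iff)
    then show ?thesis by (intro divide_right_mono) auto
  qed
  also have "\<dots> = real k ^ 2 / card V"
    using k V by (cases k) (auto simp: field_simps)
  finally show ?thesis .
qed

section \<open>Sampling\<close>

lemma closed_walk_of_relpow:
  assumes "(x, x) \<in> E ^^ k" "0 < k" "E \<subseteq> V \<times> V"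
  shows "closed_walks k V E \<noteq> {}"
proof -
  obtain f where f: "f 0 = x" "f k = x" "\<And>j. j < k \<Longrightarrow> (f j, f (Suc j)) \<in> E"
    using assms(1) unfolding relpow_fun_conv by blast
  have wrap: "f (Suc j mod k) = f (Suc j)" if "j < k" for j
    using f(1,2) that by (cases "Suc j = k") auto
  have "closed_walk k E f" using f(3) wrap by (simp add: closed_walk_def)
  moreover have "closed_walk k E (restrict f {..<k}) = closed_walk k E f"
    by (rule closed_walk_cong) simp
  moreover have "f j \<in> V" if "j < k" for j using f(3)[OF that] assms(3) by auto
  ultimately have "restrict f {..<k} \<in> closed_walks k V E" by (auto simp: closed_walks_def)
  then show ?thesis by blast
qed

lemma card_closed_walks5_le:
  assumes V: "finite V" and E: "E \<subseteq> V \<times> V" and l: "l \<in> {8, 13}" and no: "closed_walks l V E = {}"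
  shows "625 * real (card (closed_walks 5 V E)) \<le> real (card V) ^ 5"
proof -
  have nol: "(x, x) \<notin> E ^^ l" for x
    using closed_walk_of_relpow[OF _ _ E] no l by auto
  interpret few_closed_walks V E
  proof
    fix x assume 5: "(x, x) \<in> E ^^ 5"
    show "(x, x) \<notin> E ^^ 3"
      using relpow_add_trans[OF 5, of x 3] relpow_add_trans[OF 5 relpow_add_trans[OF 5, of x 3]] nol[of x] l by auto
    show "(x, x) \<notin> E ^^ 4"
    proof
      assume 4: "(x, x) \<in> E ^^ 4"
      show False
        using relpow_add_trans[OF 4 4] relpow_add_trans[OF 5 relpow_add_trans[OF 4 4]] nol[of x] l by auto
    qed
    \<comment> \<open>For \<open>l = 8\<close> this is the absence of closed \<open>l\<close>-walks;
      for \<open>l = 13\<close> a closed 5-walk is added.\<close>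
    show "(x, x) \<notin> E ^^ 8"
      using relpow_add_trans[OF 5, of x 8] nol[of x] l by auto
  qed (use V E in auto)
  let ?t = "\<lambda>f. (f 0, f 1, f 2, f 3, f 4)"
  have "card (closed_walks 5 V E) \<le> card (closed5 E)"
  proof (rule card_inj_on_le[of ?t])
    show "inj_on ?t (closed_walks 5 V E)"
    proof (rule inj_onI)
      fix f g assume f: "f \<in> closed_walks 5 V E" "g \<in> closed_walks 5 V E" and eq: "?t f = ?t g"
      show "f = g"
      proof (rule PiE_ext)
        show "f \<in> {..<5::nat} \<rightarrow>\<^sub>E V" "g \<in> {..<5::nat} \<rightarrow>\<^sub>E V" using f by (auto simp: closed_walks_def)
        fix x :: nat assume "x \<in> {..<5}"
        then have "x \<in> {0, 1, 2, 3, 4}" by auto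
        then show "f x = g x" using eq by auto
      qed
    qed
    show "?t ` closed_walks 5 V E \<subseteq> closed5 E"
    proof (rule image_subsetI)
      fix f assume "f \<in> closed_walks 5 V E"
      then have "(f j, f (Suc j mod 5)) \<in> E" if "j < 5" for j
        using that by (simp add: closed_walks_def closed_walk_def)
      from this[of 0] this[of 1] this[of 2] this[of 3] this[of 4] show "?t f \<in> closed5 E"
        by (simp add: closed5_def numeral_2_eq_2)
    qed
  qed (rule finite_closed5)
  then show ?thesis using card_closed5_le by linarith
qed

text \<open>
  Average the bound of \<open>card_closed_walks5_le\<close> over the pullbacks of \<open>E\<close> along all maps
  \<open>\<phi>\<close> from \<open>m\<close> points to \<open>V\<close>; those with closed \<open>l\<close>-walks are few.
\<close>
lemma closed_walks5_sampling:
  fixes p :: real and m :: nat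
  assumes V: "finite V" "0 < card V" and E: "E \<subseteq> V \<times> V" and l: "l \<in> {8, 13}" and m: "5 \<le> m"
    and p: "\<And>i. i \<in> {..<l} \<rightarrow>\<^sub>E {..<m} \<Longrightarrow> walk_density l V E {..<m} i \<le> p"
  shows "card (closed_walks 5 V E) / real (card V) ^ 5 \<le> 1 / 625 + 25 / m + real m ^ l * p"
proof -
  let ?n = "real (card V)" and ?\<Phi> = "{..<m} \<rightarrow>\<^sub>E V"
  let ?E = "\<lambda>\<phi>. {(x, y). x < m \<and> y < m \<and> (\<phi> x, \<phi> y) \<in> E}"
  let ?W = "\<lambda>\<phi>. closed_walks 5 {..<m} (?E \<phi>)"
  let ?I = "{i \<in> {..<5::nat} \<rightarrow>\<^sub>E {..<m}. inj_on i {..<5}}"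
  let ?B = "{\<phi> \<in> ?\<Phi>. closed_walks l {..<m} (?E \<phi>) \<noteq> {}}"
  define T where "T = real (card (closed_walks 5 V E))"
  have Vne: "V \<noteq> {}" using V by auto
  have fin\<Phi>: "finite ?\<Phi>" using V by (intro finite_PiE) auto
  have card\<Phi>: "real (card ?\<Phi>) = ?n ^ m" by (simp add: card_funcsetE)
  have cw: "closed_walks k {..<m} (?E \<phi>) = {i \<in> {..<k} \<rightarrow>\<^sub>E {..<m}. closed_walk k E (\<phi> \<circ> i)}" for k \<phi>
  proof -
    have "closed_walk k (?E \<phi>) i \<longleftrightarrow> closed_walk k E (\<phi> \<circ> i)" if i: "i \<in> {..<k} \<rightarrow>\<^sub>E {..<m}" for i
    proof -
      have "i j < m" if "j < k" for j using PiE_mem[OF i, of j] that by simp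
      moreover have "Suc j mod k < k" if "j < k" for j using that by auto
      ultimately show ?thesis by (auto simp: closed_walk_def)
    qed
    then show ?thesis unfolding closed_walks_def by blast
  qed
  have finI: "finite ({..<k} \<rightarrow>\<^sub>E {..<m})" for k :: nat by (intro finite_PiE) auto
  have cardI: "card ({..<k} \<rightarrow>\<^sub>E {..<m}) = m ^ k" for k :: nat by (simp add: card_funcsetE)

  \<comment> \<open>Double counting of pairs of a sample \<open>\<phi>\<close> and a pattern
    \<open>i\<close>.\<close>
  have swap: "(\<Sum>\<phi>\<in>?\<Phi>. card {i \<in> {..<k} \<rightarrow>\<^sub>E {..<m}. closed_walk k E (\<phi> \<circ> i)})
      = (\<Sum>i\<in>{..<k} \<rightarrow>\<^sub>E {..<m}. card {\<phi> \<in> ?\<Phi>. closed_walk k E (\<phi> \<circ> i)})" for k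
    by (rule sum_multicount_gen) (use fin\<Phi> finI in auto)
  have card_inj: "real m ^ 5 - 25 * real m ^ 4 \<le> card ?I"
  proof -
    have "card ({..<5::nat} \<rightarrow>\<^sub>E {..<m}) = card (?I \<union> {i \<in> {..<5::nat} \<rightarrow>\<^sub>E {..<m}. \<not> inj_on i {..<5}})"
      by (rule arg_cong[of _ _ card]) auto
    also have "\<dots> \<le> card ?I + card {i \<in> {..<5::nat} \<rightarrow>\<^sub>E {..<m}. \<not> inj_on i {..<5}}" by (rule card_Un_le)
    also have "\<dots> \<le> card ?I + 25 * m ^ 4" using card_noninj_le[of "{..<m}" 5] by simp
    finally have "m ^ 5 \<le> card ?I + 25 * m ^ 4" unfolding cardI .
    then have "real (m ^ 5) \<le> real (card ?I + 25 * m ^ 4)" by (simp only: of_nat_le_iff)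
    then show ?thesis by simp
  qed

  \<comment> \<open>Every injective pattern sees each closed 5-walk of \<open>E\<close> in exactly
    \<open>card V ^ (m - 5)\<close> samples; for a lower bound the other patterns may be
    dropped.\<close>
  have "card ?I * (card (closed_walks 5 V E) * card V ^ (m - 5))
      = (\<Sum>i\<in>?I. card {\<phi> \<in> ?\<Phi>. closed_walk 5 E (\<phi> \<circ> i)})"
  proof -
    have "card {\<phi> \<in> ?\<Phi>. closed_walk 5 E (\<phi> \<circ> i)} = card (closed_walks 5 V E) * card V ^ (m - 5)" if "i \<in> ?I" for i
      using that by (subst card_closed_walk_comp_inj) auto
    then show ?thesis by simp
  qed
  also have "\<dots> \<le> (\<Sum>i\<in>{..<5::nat} \<rightarrow>\<^sub>E {..<m}. card {\<phi> \<in> ?\<Phi>. closed_walk 5 E (\<phi> \<circ> i)})"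
    using finI by (intro sum_mono2) auto
  also have "\<dots> = (\<Sum>\<phi>\<in>?\<Phi>. card (?W \<phi>))" unfolding cw swap ..
  finally have "real (card ?I * (card (closed_walks 5 V E) * card V ^ (m - 5))) \<le> real (\<Sum>\<phi>\<in>?\<Phi>. card (?W \<phi>))"
    by (simp only: of_nat_le_iff)
  then have lower: "card ?I * (T * ?n ^ (m - 5)) \<le> (\<Sum>\<phi>\<in>?\<Phi>. real (card (?W \<phi>)))"
    by (simp add: T_def)
  \<comment> \<open>Good samples satisfy the exact bound; bad ones get the trivial bound
    \<open>m ^ 5\<close>.\<close>
  have "real (card (?W \<phi>)) \<le> real m ^ 5 / 625 + (if \<phi> \<in> ?B then real m ^ 5 else 0)" if \<phi>: "\<phi> \<in> ?\<Phi>" for \<phi>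
  proof (cases "\<phi> \<in> ?B")
    case True
    have "card (?W \<phi>) \<le> card ({..<5::nat} \<rightarrow>\<^sub>E {..<m})"
      unfolding cw by (intro card_mono finI) auto
    then have "real (card (?W \<phi>)) \<le> real m ^ 5" unfolding cardI of_nat_power[symmetric] of_nat_le_iff .
    then show ?thesis unfolding if_P[OF True] by (intro add_increasing) auto
  next
    case False
    then have "625 * real (card (?W \<phi>)) \<le> real (card {..<m}) ^ 5"
      using \<phi> by (intro card_closed_walks5_le[OF _ _ l]) auto
    then show ?thesis using False by simp
  qed
  then have "(\<Sum>\<phi>\<in>?\<Phi>. real (card (?W \<phi>))) \<le> (\<Sum>\<phi>\<in>?\<Phi>. real m ^ 5 / 625 + (if \<phi> \<in> ?B then real m ^ 5 else 0))"
    by (rule sum_mono)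
  also have "\<dots> = ?n ^ m * (real m ^ 5 / 625) + card ?B * real m ^ 5"
    using fin\<Phi> by (simp add: sum.distrib sum.If_cases card\<Phi> Int_def)
  also have "\<dots> \<le> ?n ^ m * (real m ^ 5 / 625) + (real m ^ l * p * ?n ^ m) * real m ^ 5"
  proof -
    have n0: "?n \<noteq> 0" using V(2) by linarith
    have wd: "walk_density l V E {..<m} i * ?n ^ m = real (card {\<phi> \<in> ?\<Phi>. closed_walk l E (\<phi> \<circ> i)})" for i
      unfolding walk_density_def card_lessThan times_divide_eq_left
      by (rule nonzero_mult_div_cancel_right[OF power_not_zero[OF n0]])
    \<comment> \<open>Union bound over the \<open>m ^ l\<close> patterns, each of density at most
      \<open>p\<close>.\<close>
    have "?B \<subseteq> (\<Union>i\<in>{..<l} \<rightarrow>\<^sub>E {..<m}. {\<phi> \<in> ?\<Phi>. closed_walk l E (\<phi> \<circ> i)})"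
      unfolding cw by blast
    then have "card ?B \<le> card (\<Union>i\<in>{..<l} \<rightarrow>\<^sub>E {..<m}. {\<phi> \<in> ?\<Phi>. closed_walk l E (\<phi> \<circ> i)})"
      using fin\<Phi> finI by (intro card_mono) auto
    also have "\<dots> \<le> (\<Sum>i\<in>{..<l} \<rightarrow>\<^sub>E {..<m}. card {\<phi> \<in> ?\<Phi>. closed_walk l E (\<phi> \<circ> i)})"
      by (rule card_UN_le[OF finI])
    finally have "real (card ?B) \<le> real (\<Sum>i\<in>{..<l} \<rightarrow>\<^sub>E {..<m}. card {\<phi> \<in> ?\<Phi>. closed_walk l E (\<phi> \<circ> i)})"
      by (simp only: of_nat_le_iff)
    also have "\<dots> = (\<Sum>i\<in>{..<l} \<rightarrow>\<^sub>E {..<m}. walk_density l V E {..<m} i * ?n ^ m)"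
      by (simp only: wd of_nat_sum)
    also have "\<dots> \<le> (\<Sum>i\<in>{..<l} \<rightarrow>\<^sub>E {..<m}. p * ?n ^ m)"
      using p by (intro sum_mono mult_right_mono) auto
    also have "\<dots> = real m ^ l * p * ?n ^ m" by (simp add: cardI)
    finally show ?thesis by (intro add_left_mono mult_right_mono) auto
  qed
  finally have upper: "(\<Sum>\<phi>\<in>?\<Phi>. real (card (?W \<phi>))) \<le> ?n ^ m * real m ^ 5 * (1 / 625 + real m ^ l * p)"
    by (simp add: algebra_simps)
  define d where "d = T / ?n ^ 5"
  have nm: "?n ^ m = ?n ^ (m - 5) * ?n ^ 5" using m by (simp flip: power_add)
  have Td: "T * ?n ^ (m - 5) = ?n ^ m * d" unfolding nm d_def using V by auto
  have "?n ^ m * (card ?I * d) \<le> ?n ^ m * (real m ^ 5 * (1 / 625 + real m ^ l * p))"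
    using order_trans[OF lower upper] unfolding Td by (simp only: mult_ac)
  then have I: "card ?I * d \<le> real m ^ 5 * (1 / 625 + real m ^ l * p)"
    using V Vne by (simp add: mult_le_cancel_left_pos card_gt_0_iff)
  have "card (closed_walks 5 V E) \<le> card ({..<5::nat} \<rightarrow>\<^sub>E V)"
    unfolding closed_walks_def using V by (intro card_mono finite_PiE) auto
  also have "\<dots> = card V ^ 5" by (simp add: card_funcsetE)
  finally have "real (card (closed_walks 5 V E)) \<le> real (card V ^ 5)" by (simp only: of_nat_le_iff)
  then have d: "0 \<le> d" "d \<le> 1" using V by (auto simp: d_def T_def)
  have "real m ^ 5 * (d - 25 / m) = real m ^ 5 * d - 25 * real m ^ 4"
    using m by (simp add: field_simps eval_nat_numeral)
  \<comment> \<open>Here \<open>d \<le> 1\<close> enters.\<close>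
  also have "\<dots> \<le> real m ^ 5 * d - 25 * real m ^ 4 * d"
    using d by (simp add: mult_left_le)
  also have "\<dots> = (real m ^ 5 - 25 * real m ^ 4) * d" by (simp add: algebra_simps)
  also have "\<dots> \<le> card ?I * d" using card_inj d by (intro mult_right_mono) auto
  also note I
  finally have "d - 25 / m \<le> 1 / 625 + real m ^ l * p" using m by simp
  then show ?thesis unfolding d_def T_def by simp
qed

lemma closed_walks5_asymptotic:
  fixes \<epsilon> :: real
  assumes l: "l \<in> {8, 13}" and \<epsilon>: "0 < \<epsilon>"
  obtains N where "\<And>(V :: 'a set) E. finite V \<Longrightarrow> N \<le> card V \<Longrightarrow> E \<subseteq> V \<times> V \<Longrightarrow> irrefl E \<Longrightarrow>
    (\<And>f. f \<in> closed_walks l V E \<Longrightarrow> \<not> inj_on f {..<l}) \<Longrightarrow>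
    card (closed_walks 5 V E) \<le> (1 / 625 + \<epsilon>) * real (card V) ^ 5"
proof -
  \<comment> \<open>The error is split evenly: \<open>m\<close> makes \<open>25 / m\<close> at most
    \<open>\<epsilon> / 2\<close>, then \<open>p\<close> makes \<open>m ^ l * p\<close> equal to
    \<open>\<epsilon> / 2\<close>, and finally \<open>N\<close> forces all pattern densities below
    \<open>p\<close>.\<close>
  define m where "m = max 5 (nat \<lceil>50 / \<epsilon>\<rceil>)"
  have m5: "5 \<le> m" by (simp add: m_def)
  have "50 / \<epsilon> \<le> m" unfolding m_def by linarith
  then have m: "25 / m \<le> \<epsilon> / 2" using \<epsilon> m5 by (simp add: field_simps)
  define p where "p = \<epsilon> / 2 / real m ^ l"
  have p0: "0 < p" using \<epsilon> m5 by (simp add: p_def)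
  have p: "real m ^ l * p = \<epsilon> / 2" using m5 by (simp add: p_def)
  define N where "N = max 1 (nat \<lceil>real l ^ 2 / p ^ (2 ^ l)\<rceil>)"
  show thesis
  proof (rule that[of N])
    fix V :: "'a set" and E
    assume V: "finite V" "N \<le> card V" and E: "E \<subseteq> V \<times> V" "irrefl E"
      and no: "\<And>f. f \<in> closed_walks l V E \<Longrightarrow> \<not> inj_on f {..<l}"
    have V0: "0 < card V" using V(2) by (simp add: N_def)
    have "real l ^ 2 / p ^ (2 ^ l) \<le> N" unfolding N_def by linarith
    also have "\<dots> \<le> card V" using V by simp
    finally have np: "real l ^ 2 / card V \<le> p ^ (2 ^ l)" using p0 V0 by (simp add: field_simps)
    have "walk_density l V E {..<m} i \<le> p" if i: "i \<in> {..<l} \<rightarrow>\<^sub>E {..<m}" for i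
    proof -
      have im: "i ` {..<l} \<subseteq> {..<m}" using i by auto
      have "0 < l" using l by auto
      then have "walk_density l V E {..<m} i ^ (2 ^ l) \<le> real l ^ 2 / card V"
        by (intro walk_density_power_le_of_no_cycle V V0 E im no) auto
      then have "walk_density l V E {..<m} i ^ (2 ^ l) \<le> p ^ (2 ^ l)" using np by linarith
      then show ?thesis using p0 V V0 by (subst (asm) power_mono_iff) (auto intro: walk_density_bounds)
    qed
    then have "card (closed_walks 5 V E) / real (card V) ^ 5 \<le> 1 / 625 + 25 / m + real m ^ l * p"
      by (intro closed_walks5_sampling V V0 E l m5)
    also have "\<dots> \<le> 1 / 625 + \<epsilon>" using m p by simp
    finally show "card (closed_walks 5 V E) \<le> (1 / 625 + \<epsilon>) * real (card V) ^ 5"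
      using V0 by (simp add: field_simps)
  qed
qed

section \<open>Copies of directed cycles\<close>

definition cycle_graph :: "nat \<Rightarrow> (nat \<Rightarrow> 'a) \<Rightarrow> 'a pair_pre_digraph" where
  "cycle_graph k f = \<lparr>pverts = f ` {..<k}, parcs = (\<lambda>j. (f j, f (Suc j mod k))) ` {..<k}\<rparr>"

lemma parcs_dicycle: "parcs (dicycle k) = (\<lambda>j. (j, Suc j mod k)) ` {..<k}"
  by (auto simp: dicycle_def)

lemma cycle_graph_cong: "(\<And>j. j < k \<Longrightarrow> f j = g j) \<Longrightarrow> cycle_graph k f = cycle_graph k g"
  unfolding cycle_graph_def by (auto intro!: image_cong)

lemma digraph_iso_dicycle_iff:
  "digraph_iso (with_proj (dicycle k)) (with_proj S) \<longleftrightarrow> (\<exists>f. inj_on f {..<k} \<and> S = cycle_graph k f)"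
proof
  assume "digraph_iso (with_proj (dicycle k)) (with_proj S)"
  then obtain h where h: "pre_digraph.digraph_isomorphism (with_proj (dicycle k)) h"
    and S: "with_proj S = app_iso h (with_proj (dicycle k))"
    by (auto simp: digraph_iso_def)
  let ?f = "iso_verts h"
  have inj: "inj_on ?f {..<k}"
    using h by (simp add: pre_digraph.digraph_isomorphism_def dicycle_def)
  \<comment> \<open>Both graphs have pairs as arcs, so the projections are forced, and with them the
    action of \<open>h\<close> on arcs.\<close>
  have proj: "iso_tail h = fst" "iso_head h = snd"
    using S by (auto simp: with_proj_def app_iso_def)
  have "pverts S = ?f ` {..<k}"
    using S by (simp add: with_proj_def app_iso_def dicycle_def)
  moreover have "parcs S = iso_arcs h ` parcs (dicycle k)"
    using S by (simp add: with_proj_def app_iso_def)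
  moreover have "iso_arcs h (j, Suc j mod k) = (?f j, ?f (Suc j mod k))" if "j < k" for j
  proof -
    have "(j, Suc j mod k) \<in> parcs (dicycle k)" using that by (auto simp: parcs_dicycle)
    then show ?thesis
      using h by (auto simp: pre_digraph.digraph_isomorphism_def proj prod_eq_iff)
  qed
  ultimately have "S = cycle_graph k ?f"
    by (auto simp: cycle_graph_def parcs_dicycle image_image intro!: pair_pre_digraph.equality)
  then show "\<exists>f. inj_on f {..<k} \<and> S = cycle_graph k f" using inj by blast
next
  assume "\<exists>f. inj_on f {..<k} \<and> S = cycle_graph k f"
  then obtain f where inj: "inj_on f {..<k}" and S: "S = cycle_graph k f" by blast
  let ?h = "\<lparr>iso_verts = f, iso_arcs = map_prod f f, iso_head = snd, iso_tail = fst\<rparr>"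
  have sub: "parcs (dicycle k) \<subseteq> {..<k} \<times> {..<k}" by (auto simp: parcs_dicycle)
  have "wf_digraph (with_proj (dicycle k))"
    by unfold_locales (use sub in \<open>auto simp: dicycle_def\<close>)
  moreover have "inj_on (map_prod f f) (parcs (dicycle k))"
    using map_prod_inj_on[OF inj inj] sub by (rule inj_on_subset)
  ultimately have "pre_digraph.digraph_isomorphism (with_proj (dicycle k)) ?h"
    using inj by (simp add: pre_digraph.digraph_isomorphism_def dicycle_def)
  moreover have "with_proj S = app_iso ?h (with_proj (dicycle k))"
    unfolding S by (simp add: app_iso_def with_proj_def cycle_graph_def parcs_dicycle image_image)
      (simp add: dicycle_def)
  ultimately show "digraph_iso (with_proj (dicycle k)) (with_proj S)"
    unfolding digraph_iso_def by blast
qed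

lemma copies_dicycle_eq:
  assumes "pair_wf_digraph G"
  shows "copies (dicycle k) G = cycle_graph k ` {f \<in> closed_walks k (pverts G) (parcs G). inj_on f {..<k}}"
proof (intro equalityI subsetI)
  fix S assume S: "S \<in> copies (dicycle k) G"
  then obtain f where inj: "inj_on f {..<k}" and f: "S = cycle_graph k f"
    by (auto simp: copies_def digraph_iso_dicycle_iff)
  have sub: "pverts S \<subseteq> pverts G" "parcs S \<subseteq> parcs G"
    using S by (auto simp: copies_def subgraph_def)
  \<comment> \<open>Restriction leaves the cycle unchanged and makes the walk extensional, as
    \<open>closed_walks\<close> demands.\<close>
  let ?f = "restrict f {..<k}"
  have "closed_walk k (parcs G) f" using sub f by (auto simp: closed_walk_def cycle_graph_def)
  moreover have "closed_walk k (parcs G) ?f = closed_walk k (parcs G) f" by (rule closed_walk_cong) simp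
  moreover have "f ` {..<k} \<subseteq> pverts G" using sub f by (simp add: cycle_graph_def)
  ultimately have "?f \<in> closed_walks k (pverts G) (parcs G)" by (auto simp: closed_walks_def)
  moreover have "inj_on ?f {..<k}" using inj by (simp add: inj_on_def)
  moreover have "S = cycle_graph k ?f"
    unfolding f by (rule cycle_graph_cong) simp
  ultimately show "S \<in> cycle_graph k ` {f \<in> closed_walks k (pverts G) (parcs G). inj_on f {..<k}}"
    by blast
next
  fix S assume "S \<in> cycle_graph k ` {f \<in> closed_walks k (pverts G) (parcs G). inj_on f {..<k}}"
  then obtain f where f: "f \<in> closed_walks k (pverts G) (parcs G)" "inj_on f {..<k}" "S = cycle_graph k f"
    by blast
  interpret pair_wf_digraph G by fact
  have "pverts S \<subseteq> pverts G" "parcs S \<subseteq> parcs G"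
    using f by (auto simp: closed_walks_def closed_walk_def cycle_graph_def PiE_iff)
  moreover have "wf_digraph (with_proj S)"
    by unfold_locales (auto simp: f(3) cycle_graph_def)
  ultimately have "subgraph (with_proj S) (with_proj G)"
    using wf_digraph_axioms by (auto simp: subgraph_def)
  then show "S \<in> copies (dicycle k) G"
    using f by (auto simp: copies_def digraph_iso_dicycle_iff)
qed

section \<open>Rotations: each copy yields several closed walks\<close>

lemma image_add_mod:
  fixes k r :: nat
  assumes "0 < k"
  shows "(\<lambda>j. (j + r) mod k) ` {..<k} = {..<k}"
proof (intro equalityI subsetI)
  fix i assume "i \<in> {..<k}"
  then have i: "i < k" by simp
  \<comment> \<open>The preimage of \<open>i\<close> is \<open>i - r\<close> modulo
    \<open>k\<close>, written so that natural subtraction is not truncated.\<close>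
  have "((i + (k - r mod k)) mod k + r) mod k = (i + (k - r mod k) + r mod k) mod k"
    by (simp add: mod_simps)
  also have "i + (k - r mod k) + r mod k = i + k"
    using mod_less_divisor[OF assms, of r] by linarith
  also have "(i + k) mod k = i" using i by simp
  finally show "i \<in> (\<lambda>j. (j + r) mod k) ` {..<k}"
    using assms by (intro image_eqI[of _ _ "(i + (k - r mod k)) mod k"]) auto
qed (use assms in auto)

lemma cycle_graph_rotate:
  assumes "0 < k"
  shows "cycle_graph k (\<lambda>j. f ((j + r) mod k)) = cycle_graph k f"
proof -
  have "(\<lambda>j. f ((j + r) mod k)) ` {..<k} = f ` {..<k}"
    using image_add_mod[OF assms, of r] by (metis image_image)
  moreover have "(\<lambda>j. (f ((j + r) mod k), f ((Suc j mod k + r) mod k))) ` {..<k}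
      = (\<lambda>j. (f j, f (Suc j mod k))) ` (\<lambda>j. (j + r) mod k) ` {..<k}"
    by (simp add: image_image mod_simps)
  ultimately show ?thesis unfolding cycle_graph_def image_add_mod[OF assms] by simp
qed

text \<open>Choose one injective walk \<open>F S\<close> around each copy \<open>S\<close>. Its
  \<open>k\<close> rotations all recover \<open>S\<close> as their cycle graph, and they differ in
  their starting vertices.\<close>

lemma card_copies_dicycle_le:
  assumes G: "pair_wf_digraph G" "finite (pverts G)" and k: "0 < k"
  shows "k * card (copies (dicycle k) G) \<le> card (closed_walks k (pverts G) (parcs G))"
proof -
  let ?W = "closed_walks k (pverts G) (parcs G)"
  let ?C = "copies (dicycle k) G"
  have "\<forall>S\<in>?C. \<exists>f. f \<in> ?W \<and> inj_on f {..<k} \<and> S = cycle_graph k f"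
    unfolding copies_dicycle_eq[OF G(1)] by blast
  then obtain F where F: "\<And>S. S \<in> ?C \<Longrightarrow> F S \<in> ?W \<and> inj_on (F S) {..<k} \<and> S = cycle_graph k (F S)"
    by metis
  let ?g = "\<lambda>(S, r). restrict (\<lambda>j. F S ((j + r) mod k)) {..<k}"
  have graph: "cycle_graph k (?g (S, r)) = S" if "S \<in> ?C" for S r
  proof -
    have "cycle_graph k (?g (S, r)) = cycle_graph k (\<lambda>j. F S ((j + r) mod k))"
      by (rule cycle_graph_cong) simp
    then show ?thesis using cycle_graph_rotate[OF k, of "F S" r] F[OF that] by metis
  qed
  have "inj_on ?g (?C \<times> {..<k})"
  proof (rule inj_onI)
    fix p q assume p: "p \<in> ?C \<times> {..<k}" "q \<in> ?C \<times> {..<k}" and eq: "?g p = ?g q"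
    obtain S r S' r' where pq: "p = (S, r)" "q = (S', r')" by (cases p, cases q)
    have S: "S = S'" using graph[of S r] graph[of S' r'] p eq unfolding pq by (metis mem_Sigma_iff)
    have "F S r = F S r'" using fun_cong[OF eq, of 0] k p S unfolding pq by simp
    then show "p = q" using F[of S] p S unfolding pq by (auto dest: inj_onD)
  qed
  moreover have "?g (S, r) \<in> ?W" if S: "S \<in> ?C" for S r
  proof -
    have FS: "F S \<in> {..<k} \<rightarrow>\<^sub>E pverts G" "closed_walk k (parcs G) (F S)"
      using F[OF S] by (auto simp: closed_walks_def)
    have "closed_walk k (parcs G) (\<lambda>j. F S ((j + r) mod k))"
      unfolding closed_walk_def
    proof (intro allI impI)
      fix j assume "j < k"
      have "(F S ((j + r) mod k), F S (Suc ((j + r) mod k) mod k)) \<in> parcs G"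
        using FS(2) k by (simp add: closed_walk_def)
      then show "(F S ((j + r) mod k), F S ((Suc j mod k + r) mod k)) \<in> parcs G"
        by (simp add: mod_simps)
    qed
    moreover have "closed_walk k (parcs G) (?g (S, r)) = closed_walk k (parcs G) (\<lambda>j. F S ((j + r) mod k))"
      by (rule closed_walk_cong) simp
    moreover have "F S ((j + r) mod k) \<in> pverts G" for j using PiE_mem[OF FS(1)] k by simp
    ultimately show ?thesis by (auto simp: closed_walks_def)
  qed
  then have "?g ` (?C \<times> {..<k}) \<subseteq> ?W" by blast
  moreover have "finite ?W" unfolding closed_walks_def using G(2) by (auto intro!: finite_PiE)
  ultimately have "card (?C \<times> {..<k}) \<le> card ?W" by (rule card_inj_on_le)
  then show ?thesis by (simp add: card_cartesian_product mult.commute)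
qed

section \<open>Lower bound: the balanced blow-up, with residue classes modulo 5 as parts\<close>

definition blowup5 :: "nat \<Rightarrow> nat pair_pre_digraph" where
  "blowup5 n = \<lparr>pverts = {..<n}, parcs = {(u, v). u < n \<and> v < n \<and> v mod 5 = Suc u mod 5}\<rparr>"

lemma oriented_blowup5: "oriented_graph (blowup5 n)"
proof -
  have "{(u, v). u < n \<and> v < n \<and> v mod 5 = Suc u mod 5} \<subseteq> {..<n} \<times> {..<n}" by auto
  then have fin: "finite {(u, v). u < n \<and> v < n \<and> v mod 5 = Suc u mod 5}"
    by (rule finite_subset) simp
  have arith: "u mod 5 \<noteq> Suc u mod 5" "v mod 5 = Suc u mod 5 \<Longrightarrow> u mod 5 \<noteq> Suc v mod 5" for u v :: nat
    by (auto simp: mod_Suc split: if_splits)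
  show ?thesis
  proof
    show "e \<in> parcs (blowup5 n) \<Longrightarrow> fst e \<noteq> snd e" for e
      using arith(1) by (cases e) (auto simp: blowup5_def)
    show "(u, v) \<in> parcs (blowup5 n) \<Longrightarrow> (v, u) \<notin> parcs (blowup5 n)" for u v
      using arith(2) by (auto simp: blowup5_def)
  qed (use fin in \<open>auto simp: blowup5_def\<close>)
qed

text \<open>Every arc raises the residue modulo 5 by one, so a walk that returns to its start has
  length divisible by 5.\<close>

lemma blowup5_closed_walk_dvd:
  assumes "f \<in> closed_walks l (pverts (blowup5 n)) (parcs (blowup5 n))" "0 < l"
  shows "5 dvd l"
proof -
  have step: "f (Suc j mod l) mod 5 = Suc (f j) mod 5" if "j < l" for j
    using assms(1) that by (auto simp: closed_walks_def closed_walk_def blowup5_def)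
  have "f j mod 5 = (f 0 + j) mod 5" if "j < l" for j
    using that
  proof (induction j)
    case (Suc j)
    then have "f (Suc j) mod 5 = Suc (f j) mod 5" using step[of j] by simp
    then show ?case using Suc by (metis Suc_lessD add_Suc_right mod_Suc_eq)
  qed simp
  from this[of "l - 1"] step[of "l - 1"] have "f 0 mod 5 = Suc (f 0 + (l - 1)) mod 5"
    using assms(2) by (metis Suc_pred' diff_less mod_Suc_eq mod_self zero_less_one)
  then have "f 0 mod 5 = (f 0 + l) mod 5" using assms(2) by simp
  then show ?thesis by presburger
qed

text \<open>Any choice of one vertex \<open>5 * x j + j\<close> from each class \<open>j\<close>
  spans a 5-cycle. Its vertex set alone determines \<open>x\<close>, since residues tell the classes
  apart.\<close>

lemma card_copies_blowup5_ge: "(n div 5) ^ 5 \<le> card (copies (dicycle 5) (blowup5 n))"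
proof -
  interpret oriented_graph "blowup5 n" by (rule oriented_blowup5)
  let ?X = "{..<5::nat} \<rightarrow>\<^sub>E {..<n div 5}"
  let ?f = "\<lambda>x. restrict (\<lambda>j. 5 * x j + j) {..<5::nat}"
  have lt: "5 * x j + j < n" if "x \<in> ?X" "j < 5" for x j
    using PiE_mem[OF that(1), of j] that(2) by simp
  have "inj_on (\<lambda>x. cycle_graph 5 (?f x)) ?X"
  proof (rule inj_onI)
    fix x y assume x: "x \<in> ?X" and y: "y \<in> ?X" and eq: "cycle_graph 5 (?f x) = cycle_graph 5 (?f y)"
    have im: "?f x ` {..<5} = ?f y ` {..<5}" using eq by (simp add: cycle_graph_def)
    show "x = y"
    proof (rule PiE_ext[OF x y])
      fix j :: nat assume j: "j \<in> {..<5}"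
      then have "5 * x j + j \<in> ?f x ` {..<5}" by (intro image_eqI[of _ _ j]) auto
      then obtain i where "i < 5" "5 * x j + j = 5 * y i + i" unfolding im by auto
      moreover from this have "i = j" using j by simp presburger
      ultimately show "x j = y j" by simp
    qed
  qed
  moreover have "(\<lambda>x. cycle_graph 5 (?f x)) ` ?X \<subseteq> copies (dicycle 5) (blowup5 n)"
  proof (rule image_subsetI)
    fix x assume x: "x \<in> ?X"
    have "closed_walk 5 (parcs (blowup5 n)) (?f x)"
      unfolding closed_walk_def
    proof (intro allI impI)
      fix j :: nat assume j: "j < 5"
      show "(?f x j, ?f x (Suc j mod 5)) \<in> parcs (blowup5 n)"
        using lt[OF x j] lt[OF x, of "Suc j mod 5"] j by (simp add: blowup5_def mod_simps)
    qed
    then have "?f x \<in> closed_walks 5 (pverts (blowup5 n)) (parcs (blowup5 n))"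
      using lt[OF x] by (auto simp: closed_walks_def blowup5_def)
    moreover have "inj_on (?f x) {..<5}" by (auto simp: inj_on_def) presburger
    ultimately show "cycle_graph 5 (?f x) \<in> copies (dicycle 5) (blowup5 n)"
      unfolding copies_dicycle_eq[OF pair_wf_digraph_axioms] by blast
  qed
  moreover have "finite (copies (dicycle 5) (blowup5 n))"
    by (rule finite_copies_card_le(1)[OF oriented_blowup5])
  ultimately have "card ?X \<le> card (copies (dicycle 5) (blowup5 n))" by (rule card_inj_on_le)
  then show ?thesis by (simp add: card_funcsetE)
qed

section \<open>Bounds on the extremal numbers\<close>

lemma ex_dicycle5_ge:
  assumes "\<not> 5 dvd l"
  shows "(n div 5) ^ 5 \<le> ex_dicycle n 5 l"
proof -
  have l: "0 < l" using assms by (cases l) auto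
  interpret oriented_graph "blowup5 n" by (rule oriented_blowup5)
  have "copies (dicycle l) (blowup5 n) = {}"
    unfolding copies_dicycle_eq[OF pair_wf_digraph_axioms] using blowup5_closed_walk_dvd[OF _ l] assms by auto
  moreover have "card (pverts (blowup5 n)) = n" by (simp add: blowup5_def)
  ultimately have "card (copies (dicycle 5) (blowup5 n)) \<le> ex_dicycle n 5 l"
    unfolding ex_dicycle_def using oriented_blowup5 by (intro Max_ge ex_dicycle_set(1)[OF l]) blast
  then show ?thesis using card_copies_blowup5_ge[of n] by linarith
qed

lemma ex_dicycle_attained:
  assumes "0 < l"
  obtains G :: "nat pair_pre_digraph" where "oriented_graph G" "card (pverts G) = n" "copies (dicycle l) G = {}"
    "ex_dicycle n k l = card (copies (dicycle k) G)"
  using Max_in[OF ex_dicycle_set[OF assms, of k n]] unfolding ex_dicycle_def by blast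

lemma ex_dicycle5_asymptotic:
  assumes l: "l \<in> {8, 13}"
  shows "(\<lambda>n. real (ex_dicycle n 5 l) - (real n / 5) ^ 5) \<in> o(\<lambda>n. real n ^ 5)"
proof (rule landau_o.smallI)
  fix c :: real assume c: "0 < c"
  obtain N where N: "\<And>(V :: nat set) E. finite V \<Longrightarrow> N \<le> card V \<Longrightarrow> E \<subseteq> V \<times> V \<Longrightarrow> irrefl E \<Longrightarrow>
    (\<And>f. f \<in> closed_walks l V E \<Longrightarrow> \<not> inj_on f {..<l}) \<Longrightarrow>
    card (closed_walks 5 V E) \<le> (1 / 625 + c) * real (card V) ^ 5"
    using closed_walks5_asymptotic[OF l c] by metis
  have l0: "0 < l" "\<not> 5 dvd l" using l by auto
  have upper: "real (ex_dicycle n 5 l) - (real n / 5) ^ 5 \<le> c * real n ^ 5" if n: "N \<le> n" for n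
  proof -
    obtain G :: "nat pair_pre_digraph" where G: "oriented_graph G" "card (pverts G) = n"
      "copies (dicycle l) G = {}" "ex_dicycle n 5 l = card (copies (dicycle 5) G)"
      using ex_dicycle_attained[OF l0(1)] by metis
    interpret oriented_graph G by (rule G)
    have "parcs G \<subseteq> pverts G \<times> pverts G" by (auto dest: wellformed')
    \<comment> \<open>A loop would be antiparallel to itself.\<close>
    moreover have "irrefl (parcs G)" using no_antiparallel by (auto simp: irrefl_def)
    moreover have "\<not> inj_on f {..<l}" if "f \<in> closed_walks l (pverts G) (parcs G)" for f
      using G(3) that unfolding copies_dicycle_eq[OF pair_wf_digraph_axioms] by blast
    ultimately have "card (closed_walks 5 (pverts G) (parcs G)) \<le> (1 / 625 + c) * real n ^ 5"
      using N[of "pverts G" "parcs G"] pair_finite_verts n G(2) by simp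
    moreover have "5 * card (copies (dicycle 5) G) \<le> card (closed_walks 5 (pverts G) (parcs G))"
      by (rule card_copies_dicycle_le[OF pair_wf_digraph_axioms pair_finite_verts]) simp
    then have "5 * real (card (copies (dicycle 5) G)) \<le> card (closed_walks 5 (pverts G) (parcs G))"
      by linarith
    ultimately have "5 * real (ex_dicycle n 5 l) \<le> (1 / 625 + c) * real n ^ 5" unfolding G(4) by linarith
    \<comment> \<open>The five rotations of a copy supply the last factor:
      \<open>625 * 5 = 5 ^ 5\<close>.\<close>
    then have "real (ex_dicycle n 5 l) \<le> (real n / 5) ^ 5 + c / 5 * real n ^ 5"
      by (simp add: power_divide algebra_simps)
    moreover have "c / 5 * real n ^ 5 \<le> c * real n ^ 5" using c by (intro mult_right_mono) auto
    ultimately show ?thesis by linarith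
  qed
  have lower: "(real n / 5) ^ 5 - real (ex_dicycle n 5 l) \<le> c * real n ^ 5" if n: "5 \<le> n" "1 / c \<le> n" for n
  proof -
    define x where "x = real n / 5"
    have x: "1 \<le> x" using n by (simp add: x_def)
    have "x - 1 \<le> real (n div 5)" unfolding x_def by linarith
    then have "(x - 1) ^ 5 \<le> real (n div 5) ^ 5" using x by (intro power_mono) auto
    also have "\<dots> = real ((n div 5) ^ 5)" by simp
    also have "\<dots> \<le> ex_dicycle n 5 l" by (simp only: of_nat_le_iff ex_dicycle5_ge[OF l0(2)])
    finally have 1: "(x - 1) ^ 5 \<le> ex_dicycle n 5 l" .
    \<comment> \<open>Bernoulli requires \<open>- 1 / x \<ge> - 1\<close>, that is
      \<open>n \<ge> 5\<close>. Rounding down thus costs at most \<open>5 * x ^ 4\<close>, which is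
      of order \<open>n ^ 4\<close>.\<close>
    have "x ^ 5 * (1 + real 5 * (- 1 / x)) \<le> x ^ 5 * (1 + - 1 / x) ^ 5"
      using x by (intro mult_left_mono Bernoulli_inequality) (auto simp: field_simps)
    also have "\<dots> = (x - 1) ^ 5" using x by (simp add: field_simps flip: power_mult_distrib)
    also have "x ^ 5 * (1 + real 5 * (- 1 / x)) = x ^ 5 - 5 * x ^ 4"
      using x by (simp add: field_simps eval_nat_numeral)
    finally have 2: "x ^ 5 - 5 * x ^ 4 \<le> (x - 1) ^ 5" .
    have "5 * x ^ 4 \<le> 1 * real n ^ 4" by (simp add: x_def power_divide)
    also have "\<dots> \<le> (c * n) * real n ^ 4" using n c by (intro mult_right_mono) (auto simp: field_simps)
    also have "\<dots> = c * real n ^ 5" by (simp add: eval_nat_numeral)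
    finally show ?thesis using 1 2 unfolding x_def[symmetric] by linarith
  qed
  have "eventually (\<lambda>n. N \<le> n \<and> 5 \<le> n \<and> nat \<lceil>1 / c\<rceil> \<le> n) at_top"
    by (intro eventually_conj eventually_ge_at_top)
  then show "eventually (\<lambda>n. norm (real (ex_dicycle n 5 l) - (real n / 5) ^ 5) \<le> c * norm (real n ^ 5)) at_top"
  proof eventually_elim
    case (elim n)
    then have "1 / c \<le> n" by linarith
    then show ?case using upper[of n] lower[of n] elim by (simp add: abs_le_iff)
  qed
qed

theorem theorem3p16:
  shows "(\<lambda>n. real (ex_dicycle n 5 8) - (real n / 5) ^ 5) \<in> o(\<lambda>n. real n ^ 5) \<and>
         (\<lambda>n. real (ex_dicycle n 5 13) - (real n / 5) ^ 5) \<in> o(\<lambda>n. real n ^ 5)"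
  using ex_dicycle5_asymptotic[of 8] ex_dicycle5_asymptotic[of 13] by simp

end
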